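(* Let $B$ be a closed subset of a metric space $X$. If $B$ is locally LIP collared in $X$, then $B$ is LIP collared in $X$.
   Context: An embedding is a homeomorphism onto its image. For a closed subset $B$ of a space $X$, a local collar of $B$ in $X$ is an embedding $c : \overline{U} \times [0,1] \to X$, where $U$ is a relatively open subset of $B$, such that $c(x,0)=x$ for all $x \in \overline{U}$, such that $c^{-1}(B) = \overline{U}\times\{0\}$, and such that $c(U\times[0,1))$ is open in $X$. A local collar of the form $c : B\times[0,1]\to X$ (with $U=B$) is called a collar of $B$ in $X$. All metrics are denoted $\Delta$; a product $X\times Y$ of metric spaces carries the metric $\Delta((x,y),(x',y'))=\Delta(x,x')+\Delta(y,y')$. A map between metric spaces is locally Lipschitz if every point of the domain has an open neighborhood over which the map is Lipschitz. An embedding $f:X\to Y$ of metric spaces is a LIP embedding if both $f$ and $f^{-1}:f(X)\to X$ are locally Lipschitz. A LIP (local) collar is a (local) collar that is a LIP embedding. $B$ is LIP collared in $X$ if it has a LIP collar in $X$. $B$ is locally LIP collared in $X$ if every $x\in B$ has a relatively open neighborhood $U\subseteq B$ such that there exists a LIP local collar $c:\overline{U}\times[0,1]\to X$ of $B$ in $X$. *)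

theory Defs
  imports "HOL-Analysis.Analysis"
begin

text \<open>The ambient metric space \<open>X\<close> is a type of class \<^class>\<open>metric_space\<close>; subsets carry the
  subspace topology and the restricted metric.\<close>

definition embedding_on :: "'a::topological_space set \<Rightarrow> ('a \<Rightarrow> 'b::topological_space) \<Rightarrow> bool" where
  "embedding_on S f \<longleftrightarrow> (\<exists>g. homeomorphism S (f ` S) f g)"

text \<open>The sum metric on a product. The library's \<^const>\<open>dist\<close> on pairs is the Euclidean
  combination of the two distances instead, so the Lipschitz notions below take the metrics as
  explicit arguments. Both metrics induce the product topology.\<close>

definition dist_sum :: "'a::metric_space \<times> 'b::metric_space \<Rightarrow> 'a \<times> 'b \<Rightarrow> real" where
  "dist_sum p q = dist (fst p) (fst q) + dist (snd p) (snd q)"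

lemma dist_le_dist_sum: "dist p q \<le> dist_sum p q"
  by (simp add: dist_sum_def dist_prod_def sqrt_sum_squares_le_sum)

lemma dist_sum_le_dist: "dist_sum p q \<le> 2 * dist p q"
  using dist_fst_le[of p q] dist_snd_le[of p q] by (simp add: dist_sum_def)

lemma open_iff_dist_sum:
  "open S \<longleftrightarrow> (\<forall>p\<in>S. \<exists>e>0. \<forall>q. dist_sum q p < e \<longrightarrow> q \<in> S)"
proof
  assume "open S"
  then show "\<forall>p\<in>S. \<exists>e>0. \<forall>q. dist_sum q p < e \<longrightarrow> q \<in> S"
    unfolding open_dist by (meson dist_le_dist_sum le_less_trans)
next
  assume R: "\<forall>p\<in>S. \<exists>e>0. \<forall>q. dist_sum q p < e \<longrightarrow> q \<in> S"
  show "open S"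
    unfolding open_dist
  proof
    fix p assume "p \<in> S"
    with R obtain e where e: "e > 0" "\<And>q. dist_sum q p < e \<Longrightarrow> q \<in> S" by blast
    have "q \<in> S" if "dist q p < e / 2" for q
      using that dist_sum_le_dist[of q p] by (intro e(2)) linarith
    then show "\<exists>e>0. \<forall>q. dist q p < e \<longrightarrow> q \<in> S"
      using e(1) half_gt_zero by blast
  qed
qed

definition locally_lipschitz_on ::
  "('a::topological_space \<Rightarrow> 'a \<Rightarrow> real) \<Rightarrow> ('b \<Rightarrow> 'b \<Rightarrow> real) \<Rightarrow> 'a set \<Rightarrow> ('a \<Rightarrow> 'b) \<Rightarrow> bool" where
  "locally_lipschitz_on d d' S f \<longleftrightarrow>
     (\<forall>x\<in>S. \<exists>V. openin (top_of_set S) V \<and> x \<in> V \<and>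
        (\<exists>L\<ge>0. \<forall>y\<in>V. \<forall>z\<in>V. d' (f y) (f z) \<le> L * d y z))"

definition LIP_embedding_on ::
  "('a::topological_space \<Rightarrow> 'a \<Rightarrow> real) \<Rightarrow> ('b::topological_space \<Rightarrow> 'b \<Rightarrow> real) \<Rightarrow>
     'a set \<Rightarrow> ('a \<Rightarrow> 'b) \<Rightarrow> bool" where
  "LIP_embedding_on d d' S f \<longleftrightarrow>
     embedding_on S f \<and>
     locally_lipschitz_on d d' S f \<and>
     locally_lipschitz_on d' d (f ` S) (inv_into S f)"

text \<open>For closed \<open>B\<close> the closure of \<open>U \<subseteq> B\<close> in \<open>B\<close> is its closure in \<open>X\<close>. Only the values of
  \<open>c\<close> on \<open>closure U \<times> {0..1}\<close> are relevant.\<close>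

definition local_collar ::
  "'a::metric_space set \<Rightarrow> 'a set \<Rightarrow> ('a \<times> real \<Rightarrow> 'a) \<Rightarrow> bool" where
  "local_collar B U c \<longleftrightarrow>
     openin (top_of_set B) U \<and>
     embedding_on (closure U \<times> {0..1}) c \<and>
     (\<forall>x\<in>closure U. c (x, 0) = x) \<and>
     {p \<in> closure U \<times> {0..1}. c p \<in> B} = closure U \<times> {0} \<and>
     open (c ` (U \<times> {0..<1}))"

definition collar :: "'a::metric_space set \<Rightarrow> ('a \<times> real \<Rightarrow> 'a) \<Rightarrow> bool" where
  "collar B c \<longleftrightarrow> local_collar B B c"

definition LIP_local_collar ::
  "'a::metric_space set \<Rightarrow> 'a set \<Rightarrow> ('a \<times> real \<Rightarrow> 'a) \<Rightarrow> bool" where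
  "LIP_local_collar B U c \<longleftrightarrow>
     local_collar B U c \<and> LIP_embedding_on dist_sum dist (closure U \<times> {0..1}) c"

definition LIP_collar :: "'a::metric_space set \<Rightarrow> ('a \<times> real \<Rightarrow> 'a) \<Rightarrow> bool" where
  "LIP_collar B c \<longleftrightarrow> collar B c \<and> LIP_embedding_on dist_sum dist (B \<times> {0..1}) c"

definition LIP_collared :: "'a::metric_space set \<Rightarrow> bool" where
  "LIP_collared B \<longleftrightarrow> (\<exists>c. LIP_collar B c)"

definition locally_LIP_collared :: "'a::metric_space set \<Rightarrow> bool" where
  "locally_LIP_collared B \<longleftrightarrow>
     (\<forall>x\<in>B. \<exists>U. openin (top_of_set B) U \<and> x \<in> U \<and> (\<exists>c. LIP_local_collar B U c))"

end

theory Submission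
  imports Defs
begin

text \<open>
  The idea is to glue an outer collar to \<open>B\<close> and then push it into \<open>X\<close>. Let
  \<open>Z = X \<times> {0} \<union> B \<times> (-\<infinity>, 0]\<close>, as a subspace of \<open>X \<times> \<real>\<close> (\<open>outer_collar\<close>). A collar of \<open>B\<close> in
  \<open>X\<close> results from a LIP embedding \<open>F\<close> of \<open>Z\<close> into itself, onto an open subset, with
  \<open>F (x, t) = (x, t + 1)\<close> for \<open>x \<in> B\<close> and \<open>t \<le> -1\<close>. Such an \<open>F\<close> maps \<open>B \<times> (-\<infinity>, -1)\<close> onto
  \<open>B \<times> (-\<infinity>, 0)\<close>, so by injectivity it sends \<open>B \<times> [-1, 0]\<close> into \<open>X \<times> {0}\<close>, and \<open>c (x, t)\<close> is read off
  from \<open>F (x, t - 1)\<close>.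

  On a patch \<open>P\<close> of \<open>B\<close> with a bilipschitz collar \<open>c\<close>, the map that is the identity of
  \<open>P \<times> (-\<infinity>, 0]\<close> and \<open>c\<close> on \<open>P \<times> [0, 3)\<close> is a bilipschitz chart of \<open>Z\<close>. In this chart one can slide
  along the lines \<open>{x} \<times> (-\<infinity>, 3)\<close> by an amount \<open>\<phi> x\<close> that vanishes away from a closed
  subset of \<open>P\<close>, and extend by the identity (\<open>exists_push\<close>). The result is a LIP homeomorphism of
  \<open>Z\<close> that moves \<open>(x, t)\<close> to \<open>(x, t + \<phi> x)\<close> whenever \<open>t \<le> -\<phi> x\<close>. Pushes multiply by adding
  their amounts, so it remains to build up the constant amount \<open>1\<close>.

  The patches may be uncountably many, so \<open>B\<close> is covered by countably many families, the \<open>n\<close>-th of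
  which consists of subsets of patches at mutual distance at least \<open>8 / 2\<^sup>n\<close>
  (\<open>separated_refinement\<close>, the first step in the proof that metric spaces are paracompact). The
  pushes of one family have disjoint supports with a gap and combine into a single push
  (\<open>push_separated_family\<close>). The amounts for the successive families are the increments of a
  sequence \<open>f\<^sub>n\<close> that rises from \<open>0\<close> and near each point of \<open>B\<close> is eventually the constant \<open>1\<close>
  (\<open>telescoping_bumps\<close>). Since the collars of the \<open>n\<close>-th family are also chosen no longer than
  \<open>1 / 2\<^sup>n\<close>, near every point of \<open>Z\<close> all but finitely many pushes are the identity.

  The infinite product \<open>F = \<Phi>\<^sub>0 \<circ> \<Phi>\<^sub>1 \<circ> \<dots>\<close> is formed with the later pushes applied first. Thus near
  each point \<open>F\<close> agrees with a finite product, which makes it an injective, open and locally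
  bilipschitz map. It may fail to be surjective, but a collar only has to be open
  (\<open>collar_from_pushes\<close>).
\<close>

section \<open>Locally Lipschitz maps\<close>

text \<open>On products this refers to the metric of the product type, which differs from the sum metric by
  a factor of at most two. Estimates are made in the sum metric, where the two coordinates separate,
  and carried over by \<open>lipschitz_on_dist_sumI\<close>.\<close>

definition locally_lip :: "'a::metric_space set \<Rightarrow> ('a \<Rightarrow> 'b::metric_space) \<Rightarrow> bool" where
  "locally_lip S f \<longleftrightarrow> (\<forall>x\<in>S. \<exists>e>0. \<exists>L. L-lipschitz_on (S \<inter> ball x e) f)"

lemma locally_lip_continuous_on:
  assumes "locally_lip S f"
  shows "continuous_on S f"
  unfolding continuous_on_eq_continuous_within
proof
  fix x assume x: "x \<in> S"
  with assms obtain e L where e: "e > 0" "L-lipschitz_on (S \<inter> ball x e) f"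
    unfolding locally_lip_def by blast
  have "continuous (at x within S \<inter> ball x e) f"
    using lipschitz_on_continuous_within[OF e(2)] x e(1) by simp
  moreover have "at x within S \<inter> ball x e = at x within S"
    by (rule at_within_nhd[where S = "ball x e"]) (use e(1) in auto)
  ultimately show "continuous (at x within S) f"
    by (simp add: continuous_within)
qed

lemma locally_lip_cong_nhd:
  assumes "\<And>x. x \<in> S \<Longrightarrow> \<exists>e>0. \<exists>g. locally_lip S g \<and> (\<forall>y\<in>S \<inter> ball x e. f y = g y)"
  shows "locally_lip S f"
  unfolding locally_lip_def
proof
  fix x assume x: "x \<in> S"
  then obtain e g where e: "e > 0" "locally_lip S g" "\<forall>y\<in>S \<inter> ball x e. f y = g y"
    using assms by blast
  then obtain e' L where e': "e' > 0" "L-lipschitz_on (S \<inter> ball x e') g"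
    using x unfolding locally_lip_def by blast
  have "L-lipschitz_on (S \<inter> ball x (min e e')) f"
    by (rule lipschitz_on_transform[OF lipschitz_on_subset[OF e'(2)]]) (use e(3) in auto)
  then show "\<exists>e>0. \<exists>L. L-lipschitz_on (S \<inter> ball x e) f"
    using e(1) e'(1) by (metis min_less_iff_conj)
qed

lemma locally_lip_id: "locally_lip S (\<lambda>x. x)"
  unfolding locally_lip_def by (intro ballI exI[of _ 1] conjI lipschitz_on_id) simp

lemma locally_lip_compose:
  assumes f: "locally_lip S f" and g: "locally_lip T g" and im: "\<And>x. x \<in> S \<Longrightarrow> f x \<in> T"
  shows "locally_lip S (\<lambda>x. g (f x))"
  unfolding locally_lip_def
proof
  fix x assume x: "x \<in> S"
  obtain e L where e: "e > 0" "L-lipschitz_on (S \<inter> ball x e) f"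
    using f x unfolding locally_lip_def by blast
  obtain e' L' where e': "e' > 0" "L'-lipschitz_on (T \<inter> ball (f x) e') g"
    using g im[OF x] unfolding locally_lip_def by blast
  obtain d where d: "d > 0" "\<And>y. y \<in> S \<Longrightarrow> dist y x < d \<Longrightarrow> dist (f y) (f x) < e'"
    using locally_lip_continuous_on[OF f] x e'(1) unfolding continuous_on_iff by blast
  have "(L' * L)-lipschitz_on (S \<inter> ball x (min e d)) (\<lambda>x. g (f x))"
  proof (rule lipschitz_on_compose2[where f = f and g = g])
    show "L-lipschitz_on (S \<inter> ball x (min e d)) f"
      by (rule lipschitz_on_subset[OF e(2)]) auto
    show "L'-lipschitz_on (f ` (S \<inter> ball x (min e d))) g"
      by (rule lipschitz_on_subset[OF e'(2)]) (use im d(2) in \<open>auto simp: dist_commute\<close>)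
  qed
  then show "\<exists>e>0. \<exists>L. L-lipschitz_on (S \<inter> ball x e) (\<lambda>x. g (f x))"
    using e(1) d(1) by (metis min_less_iff_conj)
qed

lemma lipschitz_on_dist_sumI:
  assumes "0 \<le> L" "\<And>p q. p \<in> S \<Longrightarrow> q \<in> S \<Longrightarrow> dist_sum (f p) (f q) \<le> L * dist_sum p q"
  shows "(2 * L)-lipschitz_on S f"
proof (rule lipschitz_onI)
  fix p q assume pq: "p \<in> S" "q \<in> S"
  have "dist (f p) (f q) \<le> L * dist_sum p q"
    using assms(2)[OF pq] dist_le_dist_sum[of "f p" "f q"] by linarith
  also have "\<dots> \<le> L * (2 * dist p q)"
    by (rule mult_left_mono[OF dist_sum_le_dist assms(1)])
  finally show "dist (f p) (f q) \<le> 2 * L * dist p q" by simp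
qed (use assms in simp)

definition lip_homeo :: "'a::metric_space set \<Rightarrow> ('a \<Rightarrow> 'a) \<Rightarrow> ('a \<Rightarrow> 'a) \<Rightarrow> bool" where
  "lip_homeo Z \<Phi> \<Phi>' \<longleftrightarrow> locally_lip Z \<Phi> \<and> locally_lip Z \<Phi>' \<and>
     (\<forall>z\<in>Z. \<Phi> z \<in> Z \<and> \<Phi>' z \<in> Z \<and> \<Phi>' (\<Phi> z) = z \<and> \<Phi> (\<Phi>' z) = z)"

lemma lip_homeo_compose:
  assumes "lip_homeo Z F F'" "lip_homeo Z G G'"
  shows "lip_homeo Z (\<lambda>z. F (G z)) (\<lambda>z. G' (F' z))"
proof -
  have "locally_lip Z (\<lambda>z. F (G z))"
    by (rule locally_lip_compose[where T = Z and f = G and g = F])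
      (use assms in \<open>simp_all add: lip_homeo_def\<close>)
  moreover have "locally_lip Z (\<lambda>z. G' (F' z))"
    by (rule locally_lip_compose[where T = Z and f = F' and g = G'])
      (use assms in \<open>simp_all add: lip_homeo_def\<close>)
  ultimately show ?thesis
    using assms by (simp add: lip_homeo_def)
qed

text \<open>Because of the uniform gap between the supports \<open>K i\<close>, a small ball meets at most one of them,
  so that near each point the merged map is the identity or one of the given maps.\<close>

lemma lip_homeo_merge:
  fixes K :: "'i \<Rightarrow> 'a::metric_space set"
  assumes homeo: "\<And>i. i \<in> I \<Longrightarrow> lip_homeo Z (F i) (F' i)"
    and K: "\<And>i. i \<in> I \<Longrightarrow> K i \<subseteq> Z"
    and e: "e > 0" "\<And>i j z w. i \<in> I \<Longrightarrow> j \<in> I \<Longrightarrow> i \<noteq> j \<Longrightarrow> z \<in> K i \<Longrightarrow> w \<in> K j \<Longrightarrow> e \<le> dist z w"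
    and inv: "\<And>i z. i \<in> I \<Longrightarrow> z \<in> K i \<Longrightarrow> F i z \<in> K i"
    and id: "\<And>i z. i \<in> I \<Longrightarrow> z \<in> Z - K i \<Longrightarrow> F i z = z"
  obtains \<Phi> \<Phi>' where "lip_homeo Z \<Phi> \<Phi>'"
    "\<And>i z. i \<in> I \<Longrightarrow> z \<in> K i \<Longrightarrow> \<Phi> z = F i z"
    "\<And>z. z \<in> Z \<Longrightarrow> (\<And>i. i \<in> I \<Longrightarrow> z \<notin> K i) \<Longrightarrow> \<Phi> z = z"
proof -
  have Zs: "F i z \<in> Z" "F' i z \<in> Z" "F' i (F i z) = z" "F i (F' i z) = z" if "i \<in> I" "z \<in> Z" for i z
    using homeo[OF that(1)] that(2) unfolding lip_homeo_def by auto
  have id': "F' i z = z" if "i \<in> I" "z \<in> Z - K i" for i z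
    using Zs(3)[OF that(1), of z] id[OF that] that by auto
  \<comment> \<open>\<open>F i\<close> fixes the complement of \<open>K i\<close>, so it cannot carry a point from there into \<open>K i\<close>.\<close>
  have inv': "F' i z \<in> K i" if "i \<in> I" "z \<in> K i" for i z
  proof (rule ccontr)
    have z: "z \<in> Z" using that K by auto
    assume "F' i z \<notin> K i"
    with id[OF that(1), of "F' i z"] Zs[OF that(1) z] have "F' i z = z" by simp
    with \<open>F' i z \<notin> K i\<close> that show False by simp
  qed
  define sel where "sel z = (SOME i. i \<in> I \<and> z \<in> K i)" for z
  have uniq: "i = j" if "i \<in> I" "j \<in> I" "z \<in> K i" "w \<in> K j" "dist z w < e" for i j z w
    using e(2)[OF that(1,2) _ that(3,4)] that(5) by linarith
  have sel: "sel z = i" if "i \<in> I" "z \<in> K i" for i z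
    unfolding sel_def
  proof (rule some_equality)
    show "j = i" if "j \<in> I \<and> z \<in> K j" for j
      using uniq[of j i z z] that \<open>i \<in> I\<close> \<open>z \<in> K i\<close> e(1) by simp
  qed (use that in simp)
  define merge where "merge G z = (if \<exists>i\<in>I. z \<in> K i then G (sel z) z else z)" for G :: "'i \<Rightarrow> 'a \<Rightarrow> 'a" and z
  have merge_in: "merge G z = G i z" if "i \<in> I" "z \<in> K i" for G i z
    using that sel[OF that] by (auto simp: merge_def)
  have merge_out: "merge G z = z" if "\<And>i. i \<in> I \<Longrightarrow> z \<notin> K i" for G z
    using that by (auto simp: merge_def)
  have lip: "locally_lip Z (merge G)"
    if G: "\<And>i. i \<in> I \<Longrightarrow> locally_lip Z (G i)" "\<And>i z. i \<in> I \<Longrightarrow> z \<in> Z - K i \<Longrightarrow> G i z = z" for G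
  proof (rule locally_lip_cong_nhd)
    fix z assume z: "z \<in> Z"
    show "\<exists>e>0. \<exists>g. locally_lip Z g \<and> (\<forall>y\<in>Z \<inter> ball z e. merge G y = g y)"
    proof (cases "\<exists>i\<in>I. \<exists>w\<in>K i. dist z w < e / 2")
      case True
      then obtain i w where i: "i \<in> I" "w \<in> K i" "dist z w < e / 2" by blast
      have "merge G y = G i y" if y: "y \<in> Z \<inter> ball z (e/2)" for y
      proof (cases "\<exists>j\<in>I. y \<in> K j")
        case True
        then obtain j where j: "j \<in> I" "y \<in> K j" by blast
        have "dist y w < e" using y i(3) dist_triangle2[of y w z] by (simp add: dist_commute)
        then have "j = i" using uniq[of j i y w] i j by simp
        then show ?thesis using merge_in j by simp
      next
        case False
        then have "merge G y = y" "G i y = y" using merge_out[of y G] G(2)[OF i(1), of y] y i(1) by auto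
        then show ?thesis by simp
      qed
      then show ?thesis using G(1)[OF i(1)] e(1) by (intro exI[of _ "e/2"]) auto
    next
      case False
      have "merge G y = y" if "y \<in> Z \<inter> ball z (e/2)" for y
        by (rule merge_out) (use False that in auto)
      then show ?thesis using locally_lip_id e(1) by (intro exI[of _ "e/2"]) auto
    qed
  qed
  have mm: "merge F z \<in> Z" "merge F' z \<in> Z" "merge F' (merge F z) = z" "merge F (merge F' z) = z" if "z \<in> Z" for z
  proof -
    consider i where "i \<in> I" "z \<in> K i" | "\<And>i. i \<in> I \<Longrightarrow> z \<notin> K i" by blast
    then have "merge F z \<in> Z \<and> merge F' z \<in> Z \<and> merge F' (merge F z) = z \<and> merge F (merge F' z) = z"
    proof cases
      case 1
      then show ?thesis using merge_in[OF 1(1)] inv[OF 1] inv'[OF 1] Zs[OF 1(1) that] by simp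
    next
      case 2
      then show ?thesis using merge_out[of z] that by simp
    qed
    then show "merge F z \<in> Z" "merge F' z \<in> Z" "merge F' (merge F z) = z" "merge F (merge F' z) = z" by auto
  qed
  show thesis
  proof (rule that)
    have "locally_lip Z (merge F)" by (rule lip) (use homeo id in \<open>auto simp: lip_homeo_def\<close>)
    moreover have "locally_lip Z (merge F')" by (rule lip) (use homeo id' in \<open>auto simp: lip_homeo_def\<close>)
    ultimately show "lip_homeo Z (merge F) (merge F')"
      unfolding lip_homeo_def using mm by blast
    show "merge F z = F i z" if "i \<in> I" "z \<in> K i" for i z
      using that by (rule merge_in)
    show "merge F z = z" if "\<And>i. i \<in> I \<Longrightarrow> z \<notin> K i" for z
      using that by (rule merge_out)
  qed
qed

section \<open>Pushing along a single chart\<close>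

definition outer_collar :: "'a::metric_space set \<Rightarrow> ('a \<times> real) set" where
  "outer_collar B = {z. snd z \<le> 0 \<and> (snd z < 0 \<longrightarrow> fst z \<in> B)}"

text \<open>\<open>slide s\<close> is the piecewise linear homeomorphism of the line that translates \<open>(-\<infinity>, 0]\<close> by \<open>s\<close>,
  maps \<open>[0, 2]\<close> linearly onto \<open>[s, 2]\<close> and fixes \<open>[2, \<infinity>)\<close>. For \<open>s \<le> 1\<close> its slopes are at least
  \<open>1 / 2\<close>, which bounds the Lipschitz constant of its inverse \<open>unslide s\<close>. The formula shows that
  it is also Lipschitz in \<open>s\<close>.\<close>

definition slide :: "real \<Rightarrow> real \<Rightarrow> real" where
  "slide s t = t + s * max 0 (min 1 (1 - t / 2))"

definition unslide :: "real \<Rightarrow> real \<Rightarrow> real" where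
  "unslide s u = (if u \<le> s then u - s else if u \<le> 2 then (u - s) / (1 - s / 2) else u)"

lemma slide_cases:
  "t \<le> 0 \<Longrightarrow> slide s t = t + s"
  "0 \<le> t \<Longrightarrow> t \<le> 2 \<Longrightarrow> slide s t = s + t * (1 - s / 2)"
  "2 \<le> t \<Longrightarrow> slide s t = t"
  by (auto simp: slide_def max_def min_def algebra_simps)

lemma slide_le_2: "0 \<le> s \<Longrightarrow> s \<le> 1 \<Longrightarrow> t \<le> 2 \<Longrightarrow> slide s t \<le> 2"
  using slide_cases(1)[of t s] slide_cases(2)[of t s] mult_right_mono[of t 2 "1 - s / 2"]
  by (cases "t \<le> 0") auto

lemma unslide_le_2:
  assumes "0 \<le> s" "s \<le> 1" "u \<le> 2"
  shows "unslide s u \<le> 2"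
proof -
  have "(u - s) / (1 - s / 2) \<le> 2"
    using assms by (subst pos_divide_le_eq) auto
  then show ?thesis using assms by (auto simp: unslide_def)
qed

lemma unslide_slide:
  assumes "0 \<le> s" "s \<le> 1"
  shows "unslide s (slide s t) = t"
proof -
  consider "t \<le> 0" | "0 < t" "t \<le> 2" | "2 < t" by linarith
  then show ?thesis
  proof cases
    case 2
    have "0 < t * (1 - s / 2)" using 2 assms by simp
    moreover have "t * (1 - s / 2) \<le> 2 * (1 - s / 2)"
      using 2 assms by (intro mult_right_mono) auto
    ultimately have "\<not> slide s t \<le> s" "slide s t \<le> 2" "slide s t - s = t * (1 - s / 2)"
      using 2 by (auto simp: slide_cases(2))
    then show ?thesis
      using assms by (simp add: unslide_def)
  qed (use assms in \<open>auto simp: slide_cases unslide_def\<close>)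
qed

lemma slide_unslide:
  assumes "0 \<le> s" "s \<le> 1"
  shows "slide s (unslide s u) = u"
proof -
  consider "u \<le> s" | "s < u" "u \<le> 2" | "s < u" "2 < u" by linarith
  then show ?thesis
  proof cases
    case 2
    let ?t = "(u - s) / (1 - s / 2)"
    have "0 \<le> ?t" using 2 assms by simp
    moreover have "?t \<le> 2" using unslide_le_2[OF assms 2(2)] 2 by (simp add: unslide_def)
    ultimately show ?thesis using 2 assms by (simp add: slide_cases(2) unslide_def)
  qed (use assms in \<open>auto simp: slide_cases unslide_def\<close>)
qed

lemma slide_lipschitz:
  assumes "0 \<le> s" "s \<le> 1"
  shows "\<bar>slide s t - slide s' t'\<bar> \<le> 2 * (\<bar>s - s'\<bar> + \<bar>t - t'\<bar>)"
proof -
  have combine: "x \<le> 2 * (b + a)" if "x \<le> a + p + q" "p \<le> a" "q \<le> b" "0 \<le> b" for x a b p q :: real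
    using that by simp
  define r where "r t = max 0 (min 1 (1 - t / 2))" for t :: real
  have r: "0 \<le> r t" "r t \<le> 1" "\<bar>r t - r t'\<bar> \<le> \<bar>t - t'\<bar>" for t t'
    by (auto simp: r_def max_def min_def)
  have "\<bar>slide s t - slide s' t'\<bar> = \<bar>(t - t') + s * (r t - r t') + (s - s') * r t'\<bar>"
    by (simp add: slide_def r_def algebra_simps)
  also have "\<dots> \<le> \<bar>t - t'\<bar> + \<bar>s * (r t - r t')\<bar> + \<bar>(s - s') * r t'\<bar>"
    by linarith
  finally show ?thesis
  proof (rule combine)
    have "\<bar>s * (r t - r t')\<bar> \<le> 1 * \<bar>t - t'\<bar>"
      unfolding abs_mult using assms r(3)[of t t'] by (intro mult_mono) auto
    then show "\<bar>s * (r t - r t')\<bar> \<le> \<bar>t - t'\<bar>" by simp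
    have "\<bar>(s - s') * r t'\<bar> \<le> \<bar>s - s'\<bar> * 1"
      unfolding abs_mult using r[of t'] by (intro mult_left_mono) auto
    then show "\<bar>(s - s') * r t'\<bar> \<le> \<bar>s - s'\<bar>" by simp
  qed simp
qed

lemma slide_expand:
  assumes "0 \<le> s" "s \<le> 1"
  shows "\<bar>t - t'\<bar> \<le> 2 * \<bar>slide s t - slide s t'\<bar>"
proof -
  have *: "t' - t \<le> 2 * (slide s t' - slide s t)" if "t \<le> t'" for t t'
  proof -
    have "s * (max 0 (min 1 (1 - t / 2)) - max 0 (min 1 (1 - t' / 2)))
        \<le> 1 * ((t' - t) / 2)"
      using assms that by (intro mult_mono) (auto simp: max_def min_def)
    then show ?thesis by (simp add: slide_def algebra_simps)
  qed
  show ?thesis using *[of t t'] *[of t' t] by (cases "t \<le> t'") auto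
qed

text \<open>Changing \<open>s\<close> moves a preimage only as far as the expansion bound allows: compare \<open>slide s\<close> and
  \<open>slide s'\<close> at the same preimage \<open>unslide s' u'\<close>.\<close>

lemma unslide_lipschitz:
  assumes "0 \<le> s" "s \<le> 1" "0 \<le> s'" "s' \<le> 1"
  shows "\<bar>unslide s u - unslide s' u'\<bar> \<le> 6 * (\<bar>s - s'\<bar> + \<bar>u - u'\<bar>)"
proof -
  let ?t = "unslide s u" and ?t' = "unslide s' u'"
  have weaken: "2 * (a + 2 * b) \<le> 6 * (b + a)" if "0 \<le> a" "0 \<le> b" for a b :: real
    using that by simp
  have "\<bar>?t - ?t'\<bar> \<le> 2 * \<bar>slide s ?t - slide s ?t'\<bar>"
    by (rule slide_expand) fact+
  moreover have "\<bar>slide s ?t' - slide s' ?t'\<bar> \<le> 2 * \<bar>s - s'\<bar>"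
    using slide_lipschitz[OF assms(1,2), of ?t' s' ?t'] by simp
  moreover have "slide s ?t = u" "slide s' ?t' = u'"
    using slide_unslide assms by auto
  moreover have "\<bar>u - slide s ?t'\<bar> \<le> \<bar>u - u'\<bar> + \<bar>slide s ?t' - u'\<bar>"
    by linarith
  ultimately have "\<bar>?t - ?t'\<bar> \<le> 2 * (\<bar>u - u'\<bar> + 2 * \<bar>s - s'\<bar>)" by simp
  also have "\<dots> \<le> 6 * (\<bar>s - s'\<bar> + \<bar>u - u'\<bar>)"
    using weaken[OF abs_ge_zero abs_ge_zero] .
  finally show ?thesis .
qed

lemma dist_sum_le_zero: "dist_sum p q \<le> 0 \<Longrightarrow> p = q"
  using dist_le_dist_sum[of p q] zero_le_dist[of p q] by (metis dist_le_zero_iff order_trans)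

text \<open>A collar of length \<open>3\<close> leaves room beyond the interval \<open>[0, 2]\<close> on which points slide. Thus
  the closed set over which a push acts lies inside the open image of the patch, and the push can be
  extended by the identity. Here \<open>P\<close> is just a piece of \<open>B\<close>, and \<open>c\<close> is defined over \<open>P\<close> itself
  instead of its closure.\<close>

locale collar_patch =
  fixes B P :: "'a::metric_space set" and c :: "'a \<times> real \<Rightarrow> 'a" and L :: real
  assumes P_subset: "P \<subseteq> B"
    and c_base: "x \<in> P \<Longrightarrow> c (x, 0) = x"
    and c_mem_B: "x \<in> P \<Longrightarrow> 0 \<le> t \<Longrightarrow> t \<le> 3 \<Longrightarrow> c (x, t) \<in> B \<Longrightarrow> t = 0"
    and L_ge_1: "1 \<le> L"
    and c_upper: "p \<in> P \<times> {0..3} \<Longrightarrow> q \<in> P \<times> {0..3} \<Longrightarrow> dist (c p) (c q) \<le> L * dist_sum p q"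
    and c_lower: "p \<in> P \<times> {0..3} \<Longrightarrow> q \<in> P \<times> {0..3} \<Longrightarrow> dist_sum p q \<le> L * dist (c p) (c q)"
    and open_image: "open (c ` (P \<times> {0..<3}))"
begin

text \<open>The cut-offs with \<open>max\<close> and \<open>min\<close> glue the two halves without a case distinction: for
  \<open>t \<le> 0\<close> the value at \<open>(x, t)\<close> is \<open>(c (x, 0), t) = (x, t)\<close>, and for \<open>t \<ge> 0\<close> it is
  \<open>(c (x, t), 0)\<close>.\<close>

definition chart :: "'a \<times> real \<Rightarrow> 'a \<times> real" where
  "chart p = (c (fst p, max 0 (snd p)), min 0 (snd p))"

abbreviation "M \<equiv> c ` (P \<times> {0..<3})"
abbreviation "T \<equiv> P \<times> {..<3::real}"

lemma chart_nonpos: "x \<in> P \<Longrightarrow> t \<le> 0 \<Longrightarrow> chart (x, t) = (x, t)"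
  by (simp add: chart_def c_base)

text \<open>Both halves of the chart are bilipschitz, and no distance is lost across the seam: the sum
  metric of the outer collar measures \<open>\<bar>t - u\<bar>\<close> as the part above \<open>0\<close>, which \<open>c\<close> controls, plus the
  part below \<open>0\<close>, which is kept as it is.\<close>

lemma
  assumes "p \<in> T" "q \<in> T"
  shows chart_upper: "dist_sum (chart p) (chart q) \<le> L * dist_sum p q"
    and chart_lower: "dist_sum p q \<le> L * dist_sum (chart p) (chart q)"
proof -
  obtain x t y u where [simp]: "p = (x, t)" "q = (y, u)" by fastforce
  let ?a = "\<bar>max 0 t - max 0 u\<bar>" and ?b = "\<bar>min 0 t - min 0 u\<bar>"
    and ?d = "dist (c (x, max 0 t)) (c (y, max 0 u))"
  have ab: "\<bar>t - u\<bar> = ?a + ?b" by (auto simp: max_def min_def)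
  have b: "?b \<le> L * ?b" using mult_right_mono[OF L_ge_1, of ?b] by simp
  have P: "(x, max 0 t) \<in> P \<times> {0..3}" "(y, max 0 u) \<in> P \<times> {0..3}" using assms by auto
  have 1: "?d \<le> L * (dist x y + ?a)" and 2: "dist x y + ?a \<le> L * ?d"
    using c_upper[OF P] c_lower[OF P] by (auto simp: dist_sum_def dist_real_def)
  have sp: "dist_sum p q = dist x y + (?a + ?b)" and sc: "dist_sum (chart p) (chart q) = ?d + ?b"
    using ab by (auto simp: dist_sum_def dist_real_def chart_def)
  show "dist_sum (chart p) (chart q) \<le> L * dist_sum p q"
    unfolding sp sc using 1 b by (simp add: distrib_left)
  show "dist_sum p q \<le> L * dist_sum (chart p) (chart q)"
    unfolding sp sc using 2 b by (simp add: distrib_left)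
qed

lemma inj_on_chart: "inj_on chart T"
proof (rule inj_onI)
  fix p q assume pq: "p \<in> T" "q \<in> T" "chart p = chart q"
  then have "dist_sum p q \<le> 0" using chart_lower[OF pq(1,2)] by (simp add: dist_sum_def)
  then show "p = q" by (rule dist_sum_le_zero)
qed

text \<open>As \<open>c\<close> meets \<open>B\<close> only at its bottom, the points \<open>(y, t)\<close> of the outer collar with \<open>t < 0\<close> and
  \<open>y\<close> in the image \<open>M\<close> of \<open>c\<close> are those over \<open>P\<close>. Hence the image of the chart is cut out by the
  condition that the first coordinate lies in the open set \<open>M\<close>.\<close>

lemma chart_image: "chart ` T = {z \<in> outer_collar B. fst z \<in> M}"
proof (intro set_eqI iffI)
  fix z assume "z \<in> chart ` T"
  then obtain x t where xt: "x \<in> P" "t < 3" "z = chart (x, t)" by auto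
  have "fst z \<in> M" using xt by (auto simp: chart_def)
  moreover have "z \<in> outer_collar B"
    using xt P_subset c_base by (auto simp: chart_def outer_collar_def max_def)
  ultimately show "z \<in> {z \<in> outer_collar B. fst z \<in> M}" by simp
next
  fix z assume "z \<in> {z \<in> outer_collar B. fst z \<in> M}"
  then obtain x t where xt: "z \<in> outer_collar B" "x \<in> P" "0 \<le> t" "t < 3" "fst z = c (x, t)" by auto
  show "z \<in> chart ` T"
  proof (cases "snd z < 0")
    case True
    then have "t = 0" using c_mem_B[OF xt(2,3)] xt by (auto simp: outer_collar_def)
    then have "z = chart (x, snd z)" using xt True by (simp add: chart_def prod_eq_iff)
    then show ?thesis using xt True by auto
  next
    case False
    then have "z = chart (x, t)" using xt by (simp add: chart_def prod_eq_iff outer_collar_def)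
    then show ?thesis using xt by auto
  qed
qed

lemma chart_over_iff:
  assumes "(x, t) \<in> T" "Q \<subseteq> P"
  shows "fst (chart (x, t)) \<in> c ` (Q \<times> {0..2}) \<longleftrightarrow> x \<in> Q \<and> t \<le> 2"
proof
  assume "fst (chart (x, t)) \<in> c ` (Q \<times> {0..2})"
  then obtain y u where yu: "y \<in> Q" "0 \<le> u" "u \<le> 2" "c (x, max 0 t) = c (y, u)"
    by (auto simp: chart_def)
  have "dist_sum (x, max 0 t) (y, u) \<le> 0"
    using c_lower[of "(x, max 0 t)" "(y, u)"] yu assms by auto
  then have "(x, max 0 t) = (y, u)"
    by (rule dist_sum_le_zero)
  then show "x \<in> Q \<and> t \<le> 2" using yu by auto
next
  assume "x \<in> Q \<and> t \<le> 2"
  then show "fst (chart (x, t)) \<in> c ` (Q \<times> {0..2})" by (auto simp: chart_def)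
qed

text \<open>The map of \<open>outer_collar B\<close> that acts as \<open>G (\<phi> x)\<close> on the line over \<open>x\<close> in the chart. A
  variable \<open>G\<close> treats \<^const>\<open>slide\<close> and its inverse \<^const>\<open>unslide\<close> alike.\<close>

definition transport :: "(real \<Rightarrow> real \<Rightarrow> real) \<Rightarrow> ('a \<Rightarrow> real) \<Rightarrow> 'a \<times> real \<Rightarrow> 'a \<times> real" where
  "transport G \<phi> z = (if fst z \<in> M then
     (let (x, t) = inv_into T chart z in chart (x, G (\<phi> x) t)) else z)"

lemma transport_chart: "(x, t) \<in> T \<Longrightarrow> transport G \<phi> (chart (x, t)) = chart (x, G (\<phi> x) t)"
  using chart_image inj_on_chart by (auto simp: transport_def)

text \<open>The transported map is Lipschitz on the image of the chart because the chart is bilipschitz, and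
  it is the identity off the set over \<open>c ` (Q \<times> {0..2})\<close>. These two regions are open, as the latter
  set is closed, and they cover \<open>outer_collar B\<close>. The description of the moved points keeps the
  condition \<open>\<phi> x \<noteq> 0\<close>, which is stronger than \<open>x \<in> Q\<close> and provides the local finiteness later.\<close>

lemma
  assumes \<phi>: "K-lipschitz_on UNIV \<phi>" "\<And>x. x \<in> P \<Longrightarrow> 0 \<le> \<phi> x \<and> \<phi> x \<le> 1"
    and Q: "Q \<subseteq> P" "\<And>x. x \<in> P - Q \<Longrightarrow> \<phi> x = 0" "closed (c ` (Q \<times> {0..2}))"
    and G_lip: "\<And>s t s' t'. 0 \<le> s \<Longrightarrow> s \<le> 1 \<Longrightarrow> 0 \<le> s' \<Longrightarrow> s' \<le> 1 \<Longrightarrow>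
          \<bar>G s t - G s' t'\<bar> \<le> 6 * (\<bar>s - s'\<bar> + \<bar>t - t'\<bar>)"
    and G_id: "\<And>t. G 0 t = t" "\<And>s t. 0 \<le> s \<Longrightarrow> s \<le> 1 \<Longrightarrow> 2 < t \<Longrightarrow> G s t = t"
    and G_le: "\<And>s t. 0 \<le> s \<Longrightarrow> s \<le> 1 \<Longrightarrow> t \<le> 2 \<Longrightarrow> G s t \<le> 2"
  shows transport_moves: "z \<in> outer_collar B \<Longrightarrow> transport G \<phi> z \<noteq> z \<Longrightarrow>
      \<exists>x\<in>Q. \<exists>t\<in>{0..2}. \<phi> x \<noteq> 0 \<and> fst z = c (x, t)"
    and transport_preserves_support: "z \<in> outer_collar B \<Longrightarrow> fst z \<in> c ` (Q \<times> {0..2}) \<Longrightarrow>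
      fst (transport G \<phi> z) \<in> c ` (Q \<times> {0..2})"
    and transport_in_T: "(x, t) \<in> T \<Longrightarrow> (x, G (\<phi> x) t) \<in> T"
    and transport_lip: "locally_lip (outer_collar B) (transport G \<phi>)"
proof -
  have T: "(x, G (\<phi> x) t) \<in> T" if "(x, t) \<in> T" for x t
    using that \<phi>(2)[of x] G_id(2)[of "\<phi> x" t] G_le[of "\<phi> x" t] by (cases "t \<le> 2") auto
  then show "(x, t) \<in> T \<Longrightarrow> (x, G (\<phi> x) t) \<in> T" .
  have dest: "\<exists>x t. (x, t) \<in> T \<and> z = chart (x, t)" if "z \<in> outer_collar B" "fst z \<in> M" for z
  proof -
    have "z \<in> chart ` T" unfolding chart_image using that by simp
    then show ?thesis by auto
  qed
  show moves: "\<exists>x\<in>Q. \<exists>t\<in>{0..2}. \<phi> x \<noteq> 0 \<and> fst z = c (x, t)"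
    if z: "z \<in> outer_collar B" "transport G \<phi> z \<noteq> z" for z
  proof -
    have "fst z \<in> M" using z unfolding transport_def by presburger
    then obtain x t where xt: "(x, t) \<in> T" "z = chart (x, t)" using dest z by blast
    have G: "G (\<phi> x) t \<noteq> t" using z(2) transport_chart[OF xt(1), of G \<phi>] xt by auto
    then have "\<phi> x \<noteq> 0" using G_id(1) by metis
    moreover have "t \<le> 2" using G G_id(2)[of "\<phi> x" t] \<phi>(2)[of x] xt by fastforce
    moreover have "x \<in> Q" using Q(2)[of x] xt \<open>\<phi> x \<noteq> 0\<close> by auto
    ultimately show ?thesis
      using xt by (intro bexI[of _ x] bexI[of _ "max 0 t"]) (auto simp: chart_def)
  qed
  show "fst (transport G \<phi> z) \<in> c ` (Q \<times> {0..2})"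
    if z: "z \<in> outer_collar B" "fst z \<in> c ` (Q \<times> {0..2})"
  proof -
    have "c ` (Q \<times> {0..2}) \<subseteq> M" using Q(1) by (intro image_mono) auto
    then obtain x t where xt: "(x, t) \<in> T" "z = chart (x, t)" using dest z by blast
    then have "x \<in> Q" "t \<le> 2" using chart_over_iff[OF xt(1) Q(1)] z by auto
    then have "G (\<phi> x) t \<le> 2" using G_le \<phi>(2)[of x] xt by auto
    then show ?thesis
      using chart_over_iff[OF T[OF xt(1)] Q(1)] transport_chart[OF xt(1)] xt \<open>x \<in> Q\<close> by simp
  qed
  have K: "0 \<le> K" using \<phi>(1) by (rule lipschitz_on_nonneg)
  define C where "C = L * (6 * (K + 1) + 1) * L"
  have "(2 * C)-lipschitz_on {z \<in> outer_collar B. fst z \<in> M} (transport G \<phi>)"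
  proof (rule lipschitz_on_dist_sumI)
    show "0 \<le> C" using K L_ge_1 by (simp add: C_def)
    fix z w assume "z \<in> {z \<in> outer_collar B. fst z \<in> M}" "w \<in> {z \<in> outer_collar B. fst z \<in> M}"
    then obtain x t y u where xt: "(x, t) \<in> T" "z = chart (x, t)" and yu: "(y, u) \<in> T" "w = chart (y, u)"
      using dest by blast
    have "\<bar>\<phi> x - \<phi> y\<bar> \<le> K * dist x y"
      using lipschitz_onD[OF \<phi>(1), of x y] by (simp add: dist_real_def)
    moreover have "\<bar>G (\<phi> x) t - G (\<phi> y) u\<bar> \<le> 6 * (\<bar>\<phi> x - \<phi> y\<bar> + \<bar>t - u\<bar>)"
      using G_lip \<phi>(2)[of x] \<phi>(2)[of y] xt yu by simp
    ultimately have "dist_sum (x, G (\<phi> x) t) (y, G (\<phi> y) u) \<le> dist x y + 6 * (K * dist x y + \<bar>t - u\<bar>)"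
      by (simp add: dist_sum_def dist_real_def)
    also have "\<dots> \<le> (6 * (K + 1) + 1) * (dist x y + \<bar>t - u\<bar>)"
      using K by (simp add: algebra_simps)
    also have "dist x y + \<bar>t - u\<bar> = dist_sum (x, t) (y, u)"
      by (simp add: dist_sum_def dist_real_def)
    also have "(6 * (K + 1) + 1) * dist_sum (x, t) (y, u) \<le> (6 * (K + 1) + 1) * (L * dist_sum z w)"
      using chart_lower[OF xt(1) yu(1)] xt yu K by (intro mult_left_mono) auto
    finally have 1: "dist_sum (x, G (\<phi> x) t) (y, G (\<phi> y) u) \<le> (6 * (K + 1) + 1) * (L * dist_sum z w)" .
    have "dist_sum (transport G \<phi> z) (transport G \<phi> w) \<le> L * dist_sum (x, G (\<phi> x) t) (y, G (\<phi> y) u)"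
      unfolding xt(2) yu(2) transport_chart[OF xt(1)] transport_chart[OF yu(1)]
      by (rule chart_upper[OF T[OF xt(1)] T[OF yu(1)]])
    also have "\<dots> \<le> L * ((6 * (K + 1) + 1) * (L * dist_sum z w))"
      using 1 L_ge_1 by (intro mult_left_mono) auto
    finally show "dist_sum (transport G \<phi> z) (transport G \<phi> w) \<le> C * dist_sum z w"
      by (simp add: C_def mult.assoc)
  qed
  note lip = this
  show "locally_lip (outer_collar B) (transport G \<phi>)"
    unfolding locally_lip_def
  proof
    fix z assume z: "z \<in> outer_collar B"
    show "\<exists>e>0. \<exists>L. L-lipschitz_on (outer_collar B \<inter> ball z e) (transport G \<phi>)"
    proof (cases "fst z \<in> M")
      case True
      then obtain e where e: "e > 0" "ball (fst z) e \<subseteq> M"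
        using open_image open_contains_ball by blast
      have "dist (fst z) (fst w) < e" if "dist z w < e" for w
        using that dist_fst_le[of z w] by linarith
      then have "(2 * C)-lipschitz_on (outer_collar B \<inter> ball z e) (transport G \<phi>)"
        using e(2) by (intro lipschitz_on_subset[OF lip]) auto
      then show ?thesis using e(1) by blast
    next
      case False
      then have "fst z \<in> - c ` (Q \<times> {0..2})"
        using Q(1) by (auto 4 3)
      then obtain e where e: "e > 0" "ball (fst z) e \<subseteq> - c ` (Q \<times> {0..2})"
        using Q(3) open_contains_ball open_Compl by blast
      have "transport G \<phi> w = w" if w: "w \<in> outer_collar B \<inter> ball z e" for w
      proof (rule ccontr)
        assume "transport G \<phi> w \<noteq> w"
        then have "fst w \<in> c ` (Q \<times> {0..2})" using moves[of w] w by blast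
        moreover have "dist (fst z) (fst w) < e"
          using w dist_fst_le[of z w] by simp
        ultimately show False using e(2) by auto
      qed
      then have "1-lipschitz_on (outer_collar B \<inter> ball z e) (transport G \<phi>)"
        by (intro lipschitz_on_transform[OF lipschitz_on_id]) auto
      then show ?thesis using e(1) by blast
    qed
  qed
qed

lemma exists_push:
  assumes \<phi>: "K-lipschitz_on UNIV \<phi>" "\<And>x. x \<in> P \<Longrightarrow> 0 \<le> \<phi> x \<and> \<phi> x \<le> 1"
    and Q: "Q \<subseteq> P" "\<And>x. x \<in> P - Q \<Longrightarrow> \<phi> x = 0" "closed (c ` (Q \<times> {0..2}))"
  obtains \<Phi> \<Phi>' where "lip_homeo (outer_collar B) \<Phi> \<Phi>'"
    "\<And>x t. x \<in> P \<Longrightarrow> t \<le> - \<phi> x \<Longrightarrow> \<Phi> (x, t) = (x, t + \<phi> x)"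
    "\<And>z. z \<in> outer_collar B \<Longrightarrow> fst z \<in> c ` (Q \<times> {0..2}) \<Longrightarrow> fst (\<Phi> z) \<in> c ` (Q \<times> {0..2})"
    "\<And>z. z \<in> outer_collar B \<Longrightarrow> \<Phi> z \<noteq> z \<Longrightarrow> \<exists>x\<in>Q. \<exists>t\<in>{0..2}. \<phi> x \<noteq> 0 \<and> fst z = c (x, t)"
proof -
  let ?Z = "outer_collar B"
  have s: "\<bar>slide s t - slide s' t'\<bar> \<le> 6 * (\<bar>s - s'\<bar> + \<bar>t - t'\<bar>)" if "0 \<le> s" "s \<le> 1" for s t s' t'
    using slide_lipschitz[OF that, of t s' t'] by linarith
  have s': "slide 0 t = t" "unslide 0 t = t" "2 < t \<Longrightarrow> slide s t = t"
    "0 \<le> s \<Longrightarrow> s \<le> 1 \<Longrightarrow> 2 < t \<Longrightarrow> unslide s t = t" for s t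
    using slide_cases(3)[of t s] by (auto simp: slide_def unslide_def)
  note fwd = \<phi> Q s s'(1) s'(3) slide_le_2
  note bwd = \<phi> Q unslide_lipschitz s'(2) s'(4) unslide_le_2
  let ?F = "transport slide \<phi>" and ?G = "transport unslide \<phi>"
  have "?F z \<in> ?Z \<and> ?G z \<in> ?Z \<and> ?G (?F z) = z \<and> ?F (?G z) = z" if z: "z \<in> ?Z" for z
  proof (cases "fst z \<in> M")
    case True
    then have "z \<in> chart ` T" unfolding chart_image using z by simp
    then obtain x t where xt: "(x, t) \<in> T" "z = chart (x, t)" by auto
    have T: "(x, slide (\<phi> x) t) \<in> T" "(x, unslide (\<phi> x) t) \<in> T"
      using transport_in_T[OF fwd xt(1)] transport_in_T[OF bwd xt(1)] by auto
    have "chart p \<in> ?Z" if "p \<in> T" for p using imageI[OF that, of chart] chart_image by simp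
    with T have "?F z \<in> ?Z" "?G z \<in> ?Z"
      unfolding xt(2) transport_chart[OF xt(1)] by auto
    moreover have "?G (?F z) = z" "?F (?G z) = z"
      unfolding xt(2) transport_chart[OF xt(1)] transport_chart[OF T(1)] transport_chart[OF T(2)]
      using \<phi>(2)[of x] xt(1) by (auto simp: slide_unslide unslide_slide)
    ultimately show ?thesis by simp
  next
    case False
    then show ?thesis using z by (simp add: transport_def)
  qed
  then have "lip_homeo ?Z ?F ?G"
    unfolding lip_homeo_def using transport_lip[OF fwd] transport_lip[OF bwd] by blast
  moreover have "?F (x, t) = (x, t + \<phi> x)" if "x \<in> P" "t \<le> - \<phi> x" for x t
  proof -
    have "t \<le> 0" "0 \<le> \<phi> x" using \<phi>(2)[of x] that by auto
    then have "?F (x, t) = chart (x, slide (\<phi> x) t)"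
      using transport_chart[of x t slide \<phi>] chart_nonpos[of x t] that by simp
    also have "\<dots> = (x, t + \<phi> x)"
      using that slide_cases(1)[OF \<open>t \<le> 0\<close>] chart_nonpos[of x "t + \<phi> x"] by simp
    finally show ?thesis .
  qed
  ultimately show thesis
    using that transport_preserves_support[OF fwd] transport_moves[OF fwd] by blast
qed

end

section \<open>Patches cut out of a local collar\<close>

text \<open>One map \<open>c\<close> serves all open pieces \<open>P\<close> of \<open>B\<close> inside \<open>W\<close>, so that \<open>P\<close> can be chosen after the
  covering of \<open>B\<close>. The number \<open>\<delta>\<close> bounds how far the collar reaches from its base.\<close>

definition collar_patches :: "'a::metric_space set \<Rightarrow> 'a set \<Rightarrow> real \<Rightarrow> bool" where
  "collar_patches B W \<delta> \<longleftrightarrow>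
     (\<exists>c L. \<forall>P. openin (top_of_set B) P \<and> P \<subseteq> W \<longrightarrow>
        collar_patch B P c L \<and> (\<forall>Q\<subseteq>P. closed Q \<longrightarrow> closed (c ` (Q \<times> {0..2}))) \<and>
        (\<forall>x\<in>P. \<forall>t\<in>{0..3}. dist x (c (x, t)) \<le> \<delta>))"

text \<open>Near \<open>(a, 0)\<close> a LIP local collar is bilipschitz, and it is made short by shrinking the time
  parameter by a factor \<open>\<kappa>\<close>. The radius \<open>r\<close> depends on \<open>a\<close> only and not on \<open>\<delta>\<close>, because the covering
  of \<open>B\<close> must be fixed before the lengths are.

  The closedness of \<open>c ` (Q \<times> {0..2})\<close> needs care, as the image of a local collar may fail to be
  closed when \<open>B\<close> is incomplete. Its part over \<open>U \<times> {0..<1}\<close> is open, however, and so contains a ball of radius \<open>\<rho>\<close> about \<open>a\<close>. If the patch stays in the ball of radius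
  \<open>\<rho> / 2\<close>, then every limit of points of \<open>c ` (Q \<times> {0..2})\<close> is again in the image of the collar, and
  being a homeomorphism onto its image the collar maps closed sets to relatively closed ones.\<close>

lemma local_collar_patches:
  fixes B :: "'a::metric_space set"
  assumes coll: "locally_LIP_collared B" and "a \<in> B"
  obtains r where "r > 0"
    "\<And>\<delta>. \<delta> > 0 \<Longrightarrow> collar_patches B (ball a r) \<delta>"
proof -
  obtain U c where U: "openin (top_of_set B) U" "a \<in> U" and "LIP_local_collar B U c"
    using coll \<open>a \<in> B\<close> unfolding locally_LIP_collared_def by blast
  define S where "S = closure U \<times> {0..1::real}"
  have loc: "embedding_on S c" "\<And>x. x \<in> closure U \<Longrightarrow> c (x, 0) = x"
    "{p \<in> S. c p \<in> B} = closure U \<times> {0}" "open (c ` (U \<times> {0..<1}))"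
    and lipc: "locally_lipschitz_on dist_sum dist S c"
    and lipi: "locally_lipschitz_on dist dist_sum (c ` S) (inv_into S c)"
    using \<open>LIP_local_collar B U c\<close>
    unfolding LIP_local_collar_def local_collar_def LIP_embedding_on_def S_def by auto
  obtain g where g: "homeomorphism S (c ` S) c g"
    using loc(1) unfolding embedding_on_def by blast
  have inj: "inj_on c S" using g unfolding homeomorphism_def by (metis inj_on_inverseI)
  have cont: "continuous_on S c" using g homeomorphism_cont1 by blast
  have UB: "U \<subseteq> B" using U openin_imp_subset by blast
  have UU: "U \<subseteq> closure U" by (rule closure_subset)
  have aS: "(a, 0) \<in> S" and ca: "c (a, 0) = a" using U UU loc(2) by (auto simp: S_def)
  obtain V L1 where V: "openin (top_of_set S) V" "(a, 0) \<in> V" "L1 \<ge> 0"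
    "\<And>p q. p \<in> V \<Longrightarrow> q \<in> V \<Longrightarrow> dist (c p) (c q) \<le> L1 * dist_sum p q"
    using bspec[OF lipc[unfolded locally_lipschitz_on_def] aS] by meson
  have "a \<in> c ` S" using ca aS by (metis imageI)
  then obtain V' L2 where V': "openin (top_of_set (c ` S)) V'" "a \<in> V'" "L2 \<ge> 0"
    "\<And>p q. p \<in> V' \<Longrightarrow> q \<in> V' \<Longrightarrow> dist_sum (inv_into S c p) (inv_into S c q) \<le> L2 * dist p q"
    using bspec[OF lipi[unfolded locally_lipschitz_on_def] \<open>a \<in> c ` S\<close>] by meson
  have "a \<in> c ` (U \<times> {0..<1})" using ca U by (intro image_eqI[of _ _ "(a, 0)"]) auto
  then obtain \<rho> where \<rho>: "\<rho> > 0" "ball a \<rho> \<subseteq> c ` (U \<times> {0..<1})"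
    using loc(4) open_contains_ball by blast
  define N where "N = V \<inter> (S \<inter> c -` V') \<inter> (S \<inter> c -` (ball a (\<rho> / 2)))"
  have "openin (top_of_set S) N"
    unfolding N_def
    by (intro openin_Int V continuous_openin_preimage_gen[OF cont open_ball]
        continuous_openin_preimage[OF cont _ V'(1)]) auto
  moreover have "(a, 0) \<in> N" using V V' aS ca \<rho> by (simp add: N_def)
  ultimately obtain e where e: "e > 0" "\<And>p. p \<in> S \<Longrightarrow> dist p (a, 0) < e \<Longrightarrow> p \<in> N"
    unfolding openin_euclidean_subtopology_iff by blast
  obtain r0 where r0: "r0 > 0" "ball a r0 \<inter> B \<subseteq> U"
    using U unfolding openin_contains_ball by blast
  define r where "r = min r0 (e / 2)"
  define \<eta> where "\<eta> = min 1 (e / 4)"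
  have pos: "r > 0" "\<eta> > 0" using r0 e by (auto simp: r_def \<eta>_def)
  have PN: "(x, t) \<in> N" "x \<in> U" "(x, t) \<in> S" if "x \<in> B" "dist a x < r" "0 \<le> t" "t \<le> \<eta>" for x t
  proof -
    show "x \<in> U" using that r0 by (auto simp: r_def)
    then show S: "(x, t) \<in> S" using that UU by (auto simp: S_def \<eta>_def)
    have "dist (x, t) (a, 0) \<le> dist x a + \<bar>t\<bar>"
      using dist_le_dist_sum[of "(x, t)" "(a, 0)"] by (simp add: dist_sum_def dist_real_def)
    also have "\<dots> < e" using that e by (auto simp: r_def \<eta>_def dist_commute)
    finally show "(x, t) \<in> N" using e(2) S by blast
  qed
  have hU: "homeomorphism (U \<times> {0..<1}) (c ` (U \<times> {0..<1})) c g"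
    by (rule homeomorphism_of_subsets[OF g]) (use UU in \<open>auto simp: S_def\<close>)
  define L where "L = max 1 (max L1 L2)"
  have L: "1 \<le> L" "L1 \<le> L" "L2 \<le> L" by (auto simp: L_def)
  have up: "dist (c p) (c q) \<le> L * dist_sum p q" and low: "dist_sum p q \<le> L * dist (c p) (c q)"
    if "p \<in> N" "q \<in> N" for p q
  proof -
    have nn: "0 \<le> dist_sum p q" by (simp add: dist_sum_def)
    have "dist (c p) (c q) \<le> L1 * dist_sum p q" using that V by (auto simp: N_def)
    also have "\<dots> \<le> L * dist_sum p q" using L nn by (intro mult_right_mono) auto
    finally show "dist (c p) (c q) \<le> L * dist_sum p q" .
    have "dist_sum (inv_into S c (c p)) (inv_into S c (c q)) \<le> L2 * dist (c p) (c q)"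
      using that by (intro V') (auto simp: N_def)
    then have "dist_sum p q \<le> L2 * dist (c p) (c q)"
      using that inj by (simp add: N_def)
    also have "\<dots> \<le> L * dist (c p) (c q)" using L by (intro mult_right_mono) auto
    finally show "dist_sum p q \<le> L * dist (c p) (c q)" .
  qed
  show thesis
  proof (rule that[OF pos(1)])
    fix \<delta> :: real assume \<delta>: "\<delta> > 0"
    obtain \<kappa> where \<kappa>0: "0 < \<kappa>" "\<kappa> \<le> \<eta> / 3" "\<kappa> \<le> \<delta> / (3 * L)"
    proof
      show "0 < min (\<eta> / 3) (\<delta> / (3 * L))" using pos \<delta> L by simp
    qed auto
    have "\<eta> \<le> 1" by (simp add: \<eta>_def)
    then have \<kappa>: "0 < \<kappa>" "3 * \<kappa> \<le> \<eta>" "3 * L * \<kappa> \<le> \<delta>" "\<kappa> \<le> 1"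
      using \<kappa>0 L by (auto simp: field_simps)
    define c' where "c' p = c (fst p, \<kappa> * snd p)" for p :: "'a \<times> real"
    have c'_image: "c' ` (A \<times> {0..2}) = c ` (A \<times> {0..2 * \<kappa>})"
      "c' ` (A \<times> {0..<3}) = c ` (A \<times> {0..<3 * \<kappa>})" for A
    proof -
      have sc: "(\<lambda>p. (fst p, \<kappa> * snd p)) ` (A \<times> J) = A \<times> ((*) \<kappa> ` J)" for J :: "real set"
        using image_paired_Times[of "\<lambda>x. x" "(*) \<kappa>" A J] by (simp add: case_prod_beta')
      have c': "c' ` X = c ` ((\<lambda>p. (fst p, \<kappa> * snd p)) ` X)" for X
        unfolding c'_def by (simp add: image_image)
      have "(*) \<kappa> ` {0..2} = {0..2 * \<kappa>}"
        using \<kappa>(1) image_mult_atLeastAtMost[OF \<kappa>(1), of 0 2] by (simp add: mult.commute)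
      then show "c' ` (A \<times> {0..2}) = c ` (A \<times> {0..2 * \<kappa>})" unfolding c' sc by simp
      have "t \<in> (*) \<kappa> ` {0..<3}" if "t \<in> {0..<3 * \<kappa>}" for t
        using that \<kappa>(1) by (intro image_eqI[of _ _ "t / \<kappa>"]) (auto simp: field_simps)
      then have "(*) \<kappa> ` {0..<3} = {0..<3 * \<kappa>}"
        using \<kappa>(1) by (auto simp: mult.commute)
      then show "c' ` (A \<times> {0..<3}) = c ` (A \<times> {0..<3 * \<kappa>})" unfolding c' sc by simp
    qed
    have le: "\<kappa> * t \<le> 3 * \<kappa>" if "t \<le> 3" for t using that \<kappa>(1) by simp
    show "collar_patches B (ball a r) \<delta>"
      unfolding collar_patches_def
    proof (intro exI allI impI conjI ballI)
      fix P assume P: "openin (top_of_set B) P \<and> P \<subseteq> ball a r"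
      then have PB: "P \<subseteq> B" "\<And>x. x \<in> P \<Longrightarrow> dist a x < r" using openin_imp_subset by auto
      have PN': "(x, \<kappa> * t) \<in> N" "x \<in> U" "(x, \<kappa> * t) \<in> S" if "x \<in> P" "0 \<le> t" "t \<le> 3" for x t
      proof -
        have x: "x \<in> B" "dist a x < r" using PB that by auto
        have t: "0 \<le> \<kappa> * t" "\<kappa> * t \<le> \<eta>"
          using \<kappa>(1,2) le[OF \<open>t \<le> 3\<close>] that(2) by (simp, linarith)
        show "(x, \<kappa> * t) \<in> N" "x \<in> U" "(x, \<kappa> * t) \<in> S" using PN[OF x t] by auto
      qed
      have PU: "P \<subseteq> U"
      proof
        show "x \<in> U" if "x \<in> P" for x using PN'(2)[of x 0] that by simp
      qed
      have base: "c' (x, 0) = x" if "x \<in> P" for x using that PU UU loc(2) by (auto simp: c'_def)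
      show "collar_patch B P c' (L / \<kappa>)"
      proof
        show "P \<subseteq> B" by fact
        show "c' (x, 0) = x" if "x \<in> P" for x by (rule base[OF that])
        show "t = 0" if xt: "x \<in> P" "0 \<le> t" "t \<le> 3" "c' (x, t) \<in> B" for x t
        proof -
          have "(x, \<kappa> * t) \<in> {p \<in> S. c p \<in> B}" using PN'(3)[OF xt(1-3)] xt(4) by (simp add: c'_def)
          then show ?thesis unfolding loc(3) using \<kappa>(1) by auto
        qed
        show "1 \<le> L / \<kappa>" using L \<kappa> by (simp add: field_simps)
        fix p q :: "'a \<times> real" assume pq: "p \<in> P \<times> {0..3}" "q \<in> P \<times> {0..3}"
        let ?p = "(fst p, \<kappa> * snd p)" and ?q = "(fst q, \<kappa> * snd q)"
        have N: "?p \<in> N" "?q \<in> N"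
          using pq PN'(1)[of "fst p" "snd p"] PN'(1)[of "fst q" "snd q"] by auto
        have ds: "dist_sum ?p ?q = dist (fst p) (fst q) + \<kappa> * dist (snd p) (snd q)"
          using \<kappa>(1) by (simp add: dist_sum_def dist_real_def abs_mult flip: right_diff_distrib)
        have "\<kappa> * dist (snd p) (snd q) \<le> dist (snd p) (snd q)"
          using \<kappa> mult_right_mono[of \<kappa> 1 "dist (snd p) (snd q)"] by simp
        then have ds1: "dist_sum ?p ?q \<le> dist_sum p q" unfolding ds by (simp add: dist_sum_def)
        have "\<kappa> * dist (fst p) (fst q) \<le> dist (fst p) (fst q)"
          using \<kappa> mult_right_mono[of \<kappa> 1 "dist (fst p) (fst q)"] by simp
        then have ds2: "\<kappa> * dist_sum p q \<le> dist_sum ?p ?q"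
          unfolding ds by (simp add: dist_sum_def distrib_left)
        have "dist (c' p) (c' q) \<le> L * dist_sum ?p ?q" using up[OF N] by (simp add: c'_def)
        also have "\<dots> \<le> (L / \<kappa>) * dist_sum p q"
          using L \<kappa> ds1 by (intro mult_mono) (auto simp: field_simps dist_sum_def)
        finally show "dist (c' p) (c' q) \<le> (L / \<kappa>) * dist_sum p q" .
        have "\<kappa> * dist_sum p q \<le> L * dist (c' p) (c' q)"
          using low[OF N] ds2 by (simp add: c'_def)
        then show "dist_sum p q \<le> (L / \<kappa>) * dist (c' p) (c' q)"
          using \<kappa>(1) by (simp add: field_simps)
      next
        obtain G where G: "open G" "P = B \<inter> G" using P unfolding openin_open by auto
        have "P \<times> {0..<3 * \<kappa>} = (U \<times> {0..<1}) \<inter> (G \<times> {..<3 * \<kappa>})"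
          using G PU UB \<kappa>(2) by (auto simp: \<eta>_def)
        moreover have "open (G \<times> {..<3 * \<kappa>})" using G by (intro open_Times) auto
        ultimately have "openin (top_of_set (U \<times> {0..<1})) (P \<times> {0..<3 * \<kappa>})"
          unfolding openin_open by blast
        then have "openin (top_of_set (c ` (U \<times> {0..<1}))) (c ` (P \<times> {0..<3 * \<kappa>}))"
          by (rule homeomorphism_imp_open_map[OF hU])
        then show "open (c' ` (P \<times> {0..<3}))"
          unfolding c'_image using loc(4) openin_open_trans by blast
      qed
      show "closed (c' ` (Q \<times> {0..2}))" if Q: "Q \<subseteq> P" "closed Q" for Q
      proof -
        define A where "A = c ` (Q \<times> {0..2 * \<kappa>})"
        have QS: "Q \<times> {0..2 * \<kappa>} \<subseteq> S"
          using Q PU UU \<kappa> by (auto simp: S_def \<eta>_def)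
        have "closed (Q \<times> {0..2 * \<kappa>})" using Q by (intro closed_Times) auto
        then have "closedin (top_of_set S) (Q \<times> {0..2 * \<kappa>})"
          using QS closed_subset by blast
        then have cl: "closedin (top_of_set (c ` S)) A"
          unfolding A_def by (rule homeomorphism_imp_closed_map[OF g])
        have "Q \<times> {0..2 * \<kappa>} \<subseteq> N"
        proof
          fix p assume "p \<in> Q \<times> {0..2 * \<kappa>}"
          then have "fst p \<in> P" "0 \<le> snd p" "snd p \<le> \<eta>" using Q \<kappa> by auto
          then show "p \<in> N" using PN(1)[of "fst p" "snd p"] PB by auto
        qed
        then have "A \<subseteq> ball a (\<rho> / 2)" by (auto simp: A_def N_def)
        then have "closure A \<subseteq> cball a (\<rho> / 2)"
          by (meson ball_subset_cball closed_cball closure_minimal order_trans)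
        also have "\<dots> \<subseteq> ball a \<rho>" using \<rho>(1) by auto
        also have "\<dots> \<subseteq> c ` S" using \<rho>(2) hU UU by (force simp: S_def)
        finally have "closure A \<subseteq> c ` S" .
        then have "closure A = A"
          using cl closure_subset unfolding closedin_closed
          by (metis (no_types, lifting) Int_absorb1 closure_minimal inf.bounded_iff inf_le2 subset_antisym)
        then show ?thesis unfolding c'_image A_def[symmetric] using closed_closure by metis
      qed
      show "dist x (c' (x, t)) \<le> \<delta>" if "x \<in> P" "t \<in> {0..3}" for x t
      proof -
        have "dist (c (x, \<kappa> * 0)) (c (x, \<kappa> * t)) \<le> L * dist_sum (x, \<kappa> * 0) (x, \<kappa> * t)"
          using that by (intro up PN') auto
        also have "\<dots> = L * (\<kappa> * t)" using \<kappa>(1) that by (simp add: dist_sum_def dist_real_def abs_mult)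
        also have "\<dots> \<le> L * (3 * \<kappa>)" using le[of t] that L by (intro mult_left_mono) auto
        also have "\<dots> \<le> \<delta>" using \<kappa>(3) by (simp add: mult_ac)
        finally show ?thesis using base[OF that(1)] by (simp add: c'_def)
      qed
    qed
  qed
qed

section \<open>A countable cover by separated families\<close>

text \<open>Well-order the points of \<open>B\<close> and let \<open>E n a\<close> consist of the points whose first covering set is
  \<open>W a\<close> and which lie in \<open>W a\<close> together with their ball of radius \<open>8 / 2\<^sup>n\<close>. If \<open>a\<close> precedes \<open>b\<close>, then
  points of \<open>E n b\<close> are outside \<open>W a\<close> and hence at distance at least \<open>8 / 2\<^sup>n\<close> from \<open>E n a\<close>. The
  factor \<open>8\<close> leaves space for neighbourhoods of the sets \<open>E n a\<close> and for collars over them.\<close>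

lemma separated_refinement:
  fixes W :: "'a::metric_space \<Rightarrow> 'a set"
  assumes W: "\<And>x. x \<in> B \<Longrightarrow> open (W x) \<and> x \<in> W x"
  obtains E :: "nat \<Rightarrow> 'a \<Rightarrow> 'a set" where
    "\<And>x. x \<in> B \<Longrightarrow> \<exists>n. \<exists>a\<in>B. x \<in> E n a"
    "\<And>n a y. y \<in> E n a \<Longrightarrow> ball y (8 / 2 ^ n) \<subseteq> W a"
    "\<And>n a b y z. a \<in> B \<Longrightarrow> b \<in> B \<Longrightarrow> a \<noteq> b \<Longrightarrow> y \<in> E n a \<Longrightarrow> z \<in> E n b \<Longrightarrow> 8 / 2 ^ n \<le> dist y z"
proof -
  obtain r :: "'a rel" where r: "Well_order r \<and> Field r = UNIV"
    using well_ordering[where ?'a = 'a] by (rule exE)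
  have "linear_order_on UNIV r" and wf: "wf (r - Id)"
    using r unfolding well_order_on_def by metis+
  then have tot: "(a, b) \<in> r - Id \<or> (b, a) \<in> r - Id" if "a \<noteq> b" for a b
    using that unfolding linear_order_on_def total_on_def by blast
  define E where "E n a = {y \<in> B. ball y (8 / 2 ^ n) \<subseteq> W a \<and> (\<forall>b\<in>B. (b, a) \<in> r - Id \<longrightarrow> y \<notin> W b)}"
    for n :: nat and a
  have sep: "8 / 2 ^ n \<le> dist y z"
    if "y \<in> E n a" "z \<in> E n b" "a \<in> B" "(a, b) \<in> r - Id" for n a b y z
  proof (rule ccontr)
    assume "\<not> ?thesis"
    then have "z \<in> ball y (8 / 2 ^ n)" by simp
    then show False using that unfolding E_def by blast
  qed
  show thesis
  proof (rule that)
    show "\<exists>n. \<exists>a\<in>B. x \<in> E n a" if x: "x \<in> B" for x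
    proof -
      have "x \<in> {a \<in> B. x \<in> W a}" using W x by simp
      then obtain a where a: "a \<in> B" "x \<in> W a" "\<And>b. (b, a) \<in> r - Id \<Longrightarrow> b \<notin> {a \<in> B. x \<in> W a}"
        using wfE_min[OF wf, of x "{a \<in> B. x \<in> W a}"] by blast
      obtain e where e: "e > 0" "ball x e \<subseteq> W a" using W a open_contains_ball by blast
      obtain n where n: "(1 / 2) ^ n < e / 8" using real_arch_pow_inv[of "e / 8" "1 / 2"] e by auto
      have "8 / 2 ^ n \<le> e" using n by (simp add: power_one_over)
      then have "ball x (8 / 2 ^ n) \<subseteq> W a" using e(2) by (meson subset_ball order_trans)
      then have "x \<in> E n a" using a x by (auto simp: E_def)
      then show ?thesis using a by blast
    qed
    show "ball y (8 / 2 ^ n) \<subseteq> W a" if "y \<in> E n a" for n a y using that by (simp add: E_def)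
    show "8 / 2 ^ n \<le> dist y z" if "a \<in> B" "b \<in> B" "a \<noteq> b" "y \<in> E n a" "z \<in> E n b" for n a b y z
      using tot[OF that(3)] sep[OF that(4,5,1)] sep[OF that(5,4,2)] by (auto simp: dist_commute)
  qed
qed

section \<open>One stage: pushing along a separated family\<close>

lemma infdist_less_imp_dist:
  assumes "infdist x A < s" "A \<noteq> {}"
  obtains y where "y \<in> A" "dist x y < s"
proof -
  have "(INF a\<in>A. dist x a) < s" using assms by (simp add: infdist_notempty)
  then show thesis
    using that cINF_less_iff[OF assms(2), of "dist x" s] by (meson bdd_below.I2 zero_le_dist)
qed

text \<open>The sets \<open>E a\<close> keep a distance of \<open>8 * \<delta>\<close>. With \<open>Q a\<close> the closed \<open>2 * \<delta>\<close>-neighbourhood of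
  \<open>E a\<close> in \<open>B\<close> and \<open>P a\<close> the open \<open>3 * \<delta>\<close>-neighbourhood, the function \<open>\<phi>\<close> vanishes on
  \<open>P a - Q a\<close>, since a point there is too far from \<open>E a\<close> and from every other \<open>E b\<close>. The push over
  \<open>Q a\<close> moves only points within \<open>\<delta>\<close> of \<open>Q a\<close>. As these are less than \<open>7/2 * \<delta>\<close> away from \<open>E a\<close>, the
  supports of different pushes are at least \<open>\<delta>\<close> apart and the pushes can be merged.\<close>

lemma push_separated_family:
  fixes B :: "'a::metric_space set" and E W :: "'a \<Rightarrow> 'a set"
  assumes "closed B" and \<delta>: "\<delta> > 0"
    and patches: "\<And>a. a \<in> B \<Longrightarrow> collar_patches B (W a) \<delta>"
    and E_W: "\<And>a y. a \<in> B \<Longrightarrow> y \<in> E a \<Longrightarrow> ball y (8 * \<delta>) \<subseteq> W a"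
    and sep: "\<And>a b y z. a \<in> B \<Longrightarrow> b \<in> B \<Longrightarrow> a \<noteq> b \<Longrightarrow> y \<in> E a \<Longrightarrow> z \<in> E b \<Longrightarrow> 8 * \<delta> \<le> dist y z"
    and lip: "K-lipschitz_on UNIV \<phi>"
    and range: "\<And>x. x \<in> B \<Longrightarrow> 0 \<le> \<phi> x \<and> \<phi> x \<le> 1"
    and supp: "\<And>x. x \<in> B \<Longrightarrow> \<phi> x \<noteq> 0 \<Longrightarrow> \<exists>a\<in>B. \<exists>y\<in>E a. dist x y < 2 * \<delta>"
  obtains \<Phi> \<Phi>' where "lip_homeo (outer_collar B) \<Phi> \<Phi>'"
    "\<And>x t. x \<in> B \<Longrightarrow> t \<le> - \<phi> x \<Longrightarrow> \<Phi> (x, t) = (x, t + \<phi> x)"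
    "\<And>z. z \<in> outer_collar B \<Longrightarrow> \<Phi> z \<noteq> z \<Longrightarrow> \<exists>x\<in>B. \<phi> x \<noteq> 0 \<and> dist (fst z) x \<le> \<delta>"
proof -
  let ?Z = "outer_collar B"
  define I where "I = {a \<in> B. E a \<noteq> {}}"
  define P where "P a = {x \<in> B. infdist x (E a) < 3 * \<delta>}" for a
  define Q where "Q a = {x \<in> B. infdist x (E a) \<le> 2 * \<delta>}" for a
  have QP: "Q a \<subseteq> P a" for a using \<delta> by (auto simp: P_def Q_def)
  have Q_near: "\<exists>y\<in>E a. dist x y < 3 * \<delta>" if "a \<in> I" "x \<in> P a" for a x
    using that infdist_less_imp_dist[of x "E a" "3 * \<delta>"] by (auto simp: P_def I_def)
  have P_open: "openin (top_of_set B) (P a)" for a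
  proof -
    have "open {x. infdist x (E a) < 3 * \<delta>}"
      by (intro open_Collect_less continuous_intros)
    moreover have "P a = B \<inter> {x. infdist x (E a) < 3 * \<delta>}" by (auto simp: P_def)
    ultimately show ?thesis by (simp add: openin_open_Int)
  qed
  have Q_closed: "closed (Q a)" for a
  proof -
    have "closed {x. infdist x (E a) \<le> 2 * \<delta>}"
      by (intro closed_Collect_le continuous_intros)
    moreover have "Q a = B \<inter> {x. infdist x (E a) \<le> 2 * \<delta>}" by (auto simp: Q_def)
    ultimately show ?thesis using \<open>closed B\<close> by (simp add: closed_Int)
  qed
  have P_W: "P a \<subseteq> W a" if a: "a \<in> I" for a
  proof
    fix x assume "x \<in> P a"
    then obtain y where y: "y \<in> E a" "dist x y < 3 * \<delta>" using Q_near a by blast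
    then have "x \<in> ball y (8 * \<delta>)" using \<delta> by (simp add: dist_commute)
    then show "x \<in> W a" using E_W[of a y] y a by (auto simp: I_def)
  qed
  have zero: "\<phi> x = 0" if a: "a \<in> I" and x: "x \<in> P a - Q a" for a x
  proof (rule ccontr)
    assume "\<phi> x \<noteq> 0"
    moreover have xB: "x \<in> B" using x by (simp add: P_def)
    ultimately obtain b z where b: "b \<in> B" "z \<in> E b" "dist x z < 2 * \<delta>" using supp by blast
    obtain y where y: "y \<in> E a" "dist x y < 3 * \<delta>" using Q_near a x by blast
    have "dist y z < 8 * \<delta>"
      using dist_triangle[of y z x] b y \<delta> by (simp add: dist_commute)
    then have "a = b" using sep[of a b y z] a b y by (auto simp: I_def)
    then have "infdist x (E a) \<le> 2 * \<delta>" using infdist_le2[of z "E a" x] b by simp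
    then show False using x xB by (simp add: Q_def)
  qed
  have "\<exists>c L. collar_patch B (P a) c L \<and> closed (c ` (Q a \<times> {0..2})) \<and>
      (\<forall>x\<in>P a. \<forall>t\<in>{0..3}. dist x (c (x, t)) \<le> \<delta>)" if a: "a \<in> I" for a
  proof -
    have "a \<in> B" using a by (simp add: I_def)
    obtain c L where cL: "\<And>P. openin (top_of_set B) P \<and> P \<subseteq> W a \<longrightarrow>
        collar_patch B P c L \<and> (\<forall>Q\<subseteq>P. closed Q \<longrightarrow> closed (c ` (Q \<times> {0..2}))) \<and>
        (\<forall>x\<in>P. \<forall>t\<in>{0..3}. dist x (c (x, t)) \<le> \<delta>)"
      using patches[OF \<open>a \<in> B\<close>] unfolding collar_patches_def by metis
    note cL_P = mp[OF cL conjI[OF P_open P_W[OF a]]]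
    then have "closed (c ` (Q a \<times> {0..2}))" using QP[of a] Q_closed[of a] by blast
    with cL_P show ?thesis by blast
  qed
  then obtain c L where cL: "\<And>a. a \<in> I \<Longrightarrow>
      collar_patch B (P a) (c a) (L a) \<and> closed (c a ` (Q a \<times> {0..2})) \<and>
      (\<forall>x\<in>P a. \<forall>t\<in>{0..3}. dist x (c a (x, t)) \<le> \<delta>)"
    by metis
  have patch: "collar_patch B (P a) (c a) (L a)" and c_closed: "closed (c a ` (Q a \<times> {0..2}))"
    if "a \<in> I" for a
    using cL[OF that] by auto
  have c_short: "dist x (c a (x, t)) \<le> \<delta>" if "a \<in> I" "x \<in> P a" "t \<in> {0..3}" for a x t
    using cL[OF that(1)] that(2,3) by blast
  define C where "C a = c a ` (Q a \<times> {0..2})" for a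
  have "\<exists>F F'. lip_homeo ?Z F F' \<and>
      (\<forall>x t. x \<in> P a \<longrightarrow> t \<le> - \<phi> x \<longrightarrow> F (x, t) = (x, t + \<phi> x)) \<and>
      (\<forall>z\<in>?Z. fst z \<in> C a \<longrightarrow> fst (F z) \<in> C a) \<and>
      (\<forall>z\<in>?Z. F z \<noteq> z \<longrightarrow> (\<exists>x\<in>Q a. \<exists>t\<in>{0..2}. \<phi> x \<noteq> 0 \<and> fst z = c a (x, t)))"
    if a: "a \<in> I" for a
  proof -
    interpret collar_patch B "P a" "c a" "L a" by (rule patch[OF a])
    show ?thesis
    proof (rule exists_push[OF lip _ QP _ c_closed[OF a]])
      show "0 \<le> \<phi> x \<and> \<phi> x \<le> 1" if "x \<in> P a" for x using that range by (simp add: P_def)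
      show "\<phi> x = 0" if "x \<in> P a - Q a" for x by (rule zero[OF a that])
    qed (unfold C_def, intro exI conjI allI impI ballI, assumption, blast+)
  qed
  then obtain F F' where FF: "\<And>a. a \<in> I \<Longrightarrow> lip_homeo ?Z (F a) (F' a) \<and>
      (\<forall>x t. x \<in> P a \<longrightarrow> t \<le> - \<phi> x \<longrightarrow> F a (x, t) = (x, t + \<phi> x)) \<and>
      (\<forall>z\<in>?Z. fst z \<in> C a \<longrightarrow> fst (F a z) \<in> C a) \<and>
      (\<forall>z\<in>?Z. F a z \<noteq> z \<longrightarrow> (\<exists>x\<in>Q a. \<exists>t\<in>{0..2}. \<phi> x \<noteq> 0 \<and> fst z = c a (x, t)))"
    by metis
  have F: "lip_homeo ?Z (F a) (F' a)"
    "\<And>x t. x \<in> P a \<Longrightarrow> t \<le> - \<phi> x \<Longrightarrow> F a (x, t) = (x, t + \<phi> x)"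
    "\<And>z. z \<in> ?Z \<Longrightarrow> fst z \<in> C a \<Longrightarrow> fst (F a z) \<in> C a"
    "\<And>z. z \<in> ?Z \<Longrightarrow> F a z \<noteq> z \<Longrightarrow> \<exists>x\<in>Q a. \<exists>t\<in>{0..2}. \<phi> x \<noteq> 0 \<and> fst z = c a (x, t)"
    if "a \<in> I" for a
    using FF[OF that] by auto
  define Kz where "Kz a = {z \<in> ?Z. fst z \<in> C a}" for a
  have K_near: "\<exists>y\<in>E a. dist (fst z) y < 7/2 * \<delta>" if a: "a \<in> I" and z: "z \<in> Kz a" for a z
  proof -
    obtain x t where x: "x \<in> Q a" "t \<in> {0..2}" "fst z = c a (x, t)"
      using z by (auto simp: Kz_def C_def)
    have "infdist x (E a) < 5/2 * \<delta>" "E a \<noteq> {}" using x(1) a \<delta> by (auto simp: Q_def I_def)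
    then obtain y where y: "y \<in> E a" "dist x y < 5/2 * \<delta>" by (rule infdist_less_imp_dist)
    have "dist x (fst z) \<le> \<delta>" using c_short[OF a, of x t] x QP by auto
    then have "dist (fst z) y < 7/2 * \<delta>"
      using y dist_triangle[of "fst z" y x] by (simp add: dist_commute)
    then show ?thesis using y by blast
  qed
  obtain \<Phi> \<Phi>' where \<Phi>: "lip_homeo ?Z \<Phi> \<Phi>'"
    "\<And>a z. a \<in> I \<Longrightarrow> z \<in> Kz a \<Longrightarrow> \<Phi> z = F a z"
    "\<And>z. z \<in> ?Z \<Longrightarrow> (\<And>a. a \<in> I \<Longrightarrow> z \<notin> Kz a) \<Longrightarrow> \<Phi> z = z"
  proof (rule lip_homeo_merge[of I ?Z F F' Kz \<delta>])
    show "lip_homeo ?Z (F a) (F' a)" if "a \<in> I" for a by (rule F(1)[OF that])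
    show "Kz a \<subseteq> ?Z" for a by (auto simp: Kz_def)
    show "\<delta> > 0" by fact
    show "\<delta> \<le> dist z w" if ab: "a \<in> I" "b \<in> I" "a \<noteq> b" "z \<in> Kz a" "w \<in> Kz b" for a b z w
    proof -
      obtain y y' where y: "y \<in> E a" "dist (fst z) y < 7/2 * \<delta>" "y' \<in> E b" "dist (fst w) y' < 7/2 * \<delta>"
        using K_near[OF ab(1,4)] K_near[OF ab(2,5)] by blast
      have "8 * \<delta> \<le> dist y y'" using sep[of a b y y'] ab y by (auto simp: I_def)
      also have "\<dots> \<le> dist (fst z) y + dist (fst z) (fst w) + dist (fst w) y'"
        using dist_triangle[of y y' "fst z"] dist_triangle[of "fst z" y' "fst w"]
        by (simp add: dist_commute)
      finally show ?thesis using y dist_fst_le[of z w] by linarith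
    qed
    show "F a z \<in> Kz a" if "a \<in> I" "z \<in> Kz a" for a z
      using that F(1,3)[OF that(1)] by (auto simp: Kz_def lip_homeo_def)
    show "F a z = z" if "a \<in> I" "z \<in> ?Z - Kz a" for a z
      using that F(4)[OF that(1), of z] by (auto simp: Kz_def C_def)
    fix \<Phi> \<Phi>'
    assume "lip_homeo ?Z \<Phi> \<Phi>'" and "\<And>a z. a \<in> I \<Longrightarrow> z \<in> Kz a \<Longrightarrow> \<Phi> z = F a z"
      and "\<And>z. z \<in> ?Z \<Longrightarrow> (\<And>a. a \<in> I \<Longrightarrow> z \<notin> Kz a) \<Longrightarrow> \<Phi> z = z"
    then show thesis by (rule that)
  qed
  show thesis
  proof (rule that[OF \<Phi>(1)])
    fix x t assume x: "x \<in> B" and t: "t \<le> - \<phi> x"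
    have Z: "(x, t) \<in> ?Z" using x t range[of x] by (auto simp: outer_collar_def)
    show "\<Phi> (x, t) = (x, t + \<phi> x)"
    proof (cases "\<exists>a\<in>I. (x, t) \<in> Kz a")
      case True
      then obtain a where a: "a \<in> I" "(x, t) \<in> Kz a" by blast
      interpret collar_patch B "P a" "c a" "L a" by (rule patch[OF a(1)])
      obtain y u where y: "y \<in> Q a" "u \<in> {0..2}" "x = c a (y, u)"
        using a by (auto simp: Kz_def C_def)
      have "u = 0" using c_mem_B[of y u] y x QP by auto
      then have "x = y" "y \<in> P a" using y QP[of a] c_base[of y] by auto
      then have "x \<in> P a" by simp
      then show ?thesis using \<Phi>(2)[OF a] F(2)[OF a(1) _ t] by simp
    next
      case False
      have "\<phi> x = 0"
      proof (rule ccontr)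
        assume nz: "\<phi> x \<noteq> 0"
        then obtain a y where a: "a \<in> B" "y \<in> E a" "dist x y < 2 * \<delta>" using supp x by blast
        then have I: "a \<in> I" by (auto simp: I_def)
        interpret collar_patch B "P a" "c a" "L a" by (rule patch[OF I])
        have "x \<in> Q a" using a x infdist_le2[of y "E a" x "2 * \<delta>"] by (simp add: Q_def)
        then have "x \<in> C a"
          using QP[of a] c_base[of x] unfolding C_def by (intro image_eqI[of _ _ "(x, 0)"]) auto
        then show False using False I Z by (auto simp: Kz_def)
      qed
      then show ?thesis using \<Phi>(3)[OF Z] False by auto
    qed
  next
    fix z assume z: "z \<in> ?Z" "\<Phi> z \<noteq> z"
    then obtain a where a: "a \<in> I" "z \<in> Kz a" using \<Phi>(3) by blast
    then obtain x t where x: "x \<in> Q a" "t \<in> {0..2}" "\<phi> x \<noteq> 0" "fst z = c a (x, t)"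
      using F(4)[OF a(1) z(1)] \<Phi>(2)[OF a] z(2) by auto
    have "dist x (c a (x, t)) \<le> \<delta>" using c_short[OF a(1), of x t] x QP[of a] by auto
    then show "\<exists>x\<in>B. \<phi> x \<noteq> 0 \<and> dist (fst z) x \<le> \<delta>"
      using x by (intro bexI[of _ x]) (auto simp: dist_commute Q_def)
  qed
qed


section \<open>Locally finite compositions\<close>

lemma locally_lip_imp_locally_lipschitz_on:
  assumes "locally_lip S f"
    and d: "\<And>x y. dist x y \<le> d x y" and d': "\<And>x y. d' x y \<le> 2 * dist x y"
  shows "locally_lipschitz_on d d' S f"
  unfolding locally_lipschitz_on_def
proof
  fix x assume x: "x \<in> S"
  obtain e L where e: "e > 0" "L-lipschitz_on (S \<inter> ball x e) f"
    using assms(1) x unfolding locally_lip_def by blast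
  have L: "0 \<le> L" using e(2) by (rule lipschitz_on_nonneg)
  have "d' (f y) (f z) \<le> (2 * L) * d y z" if "y \<in> S \<inter> ball x e" "z \<in> S \<inter> ball x e" for y z
  proof -
    have "d' (f y) (f z) \<le> 2 * dist (f y) (f z)" by (rule d')
    also have "\<dots> \<le> 2 * (L * dist y z)" using lipschitz_onD[OF e(2) that] by simp
    also have "\<dots> \<le> 2 * (L * d y z)" using d[of y z] L by (simp add: mult_left_mono)
    finally show ?thesis by simp
  qed
  moreover have "openin (top_of_set S) (S \<inter> ball x e)" by (simp add: openin_open_Int)
  moreover have "x \<in> S \<inter> ball x e" using x e(1) by simp
  moreover have "0 \<le> 2 * L" using L by simp
  ultimately show "\<exists>V. openin (top_of_set S) V \<and> x \<in> V \<and>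
      (\<exists>L\<ge>0. \<forall>y\<in>V. \<forall>z\<in>V. d' (f y) (f z) \<le> L * d y z)"
    by blast
qed

text \<open>\<open>G n\<close> is the product of the first \<open>n\<close> pushes, and it shifts by \<open>f n\<close> far out on the outer collar.
  As later pushes are applied first, \<open>G n z\<close> becomes stationary as soon as all later pushes fix \<open>z\<close>,
  and then uniformly in a neighbourhood of \<open>z\<close>. In the opposite order the images could keep moving.

  The limit \<open>F\<close> inherits from the homeomorphisms \<open>G n\<close> that it is injective and has local Lipschitz
  inverses on neighbourhoods of its values (\<open>F_open\<close>), while each \<open>F (x, t)\<close> with \<open>x \<in> B\<close> and
  \<open>t \<le> -1\<close> is \<open>(x, t + 1)\<close>. These properties give all properties of the collar.\<close>

lemma collar_from_pushes:
  fixes B :: "'a::metric_space set" and f :: "nat \<Rightarrow> 'a \<Rightarrow> real"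
  assumes "closed B"
    and homeo: "\<And>n. lip_homeo (outer_collar B) (\<Phi> n) (\<Phi>' n)"
    and base: "\<And>n x t. x \<in> B \<Longrightarrow> t \<le> - (f (Suc n) x - f n x) \<Longrightarrow>
      \<Phi> n (x, t) = (x, t + (f (Suc n) x - f n x))"
    and f0: "\<And>x. f 0 x = 0" and f_nonneg: "\<And>n x. 0 \<le> f n x"
    and f1: "\<And>x. x \<in> B \<Longrightarrow> \<exists>m. \<forall>n\<ge>m. f n x = 1"
    and fin: "\<And>z. z \<in> outer_collar B \<Longrightarrow>
      \<exists>e>0. \<exists>m. \<forall>n\<ge>m. \<forall>w\<in>outer_collar B \<inter> ball z e. \<Phi> n w = w"
  shows "LIP_collared B"
proof -
  let ?Z = "outer_collar B"
  define G where "G = rec_nat (\<lambda>z. z) (\<lambda>n g z. g (\<Phi> n z))"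
  define G' where "G' = rec_nat (\<lambda>z. z) (\<lambda>n g z. \<Phi>' n (g z))"
  have G_simps: "G 0 = (\<lambda>z. z)" "\<And>n. G (Suc n) = (\<lambda>z. G n (\<Phi> n z))"
    "G' 0 = (\<lambda>z. z)" "\<And>n. G' (Suc n) = (\<lambda>z. \<Phi>' n (G' n z))"
    by (simp_all add: G_def G'_def)
  have G_homeo: "lip_homeo ?Z (G n) (G' n)" for n
  proof (induction n)
    case 0
    then show ?case by (simp add: G_simps lip_homeo_def locally_lip_id)
  next
    case (Suc n)
    then show ?case unfolding G_simps(2,4) by (rule lip_homeo_compose[OF _ homeo])
  qed
  have G_Z: "G n z \<in> ?Z" "G' n z \<in> ?Z" "G' n (G n z) = z" "G n (G' n z) = z" if "z \<in> ?Z" for n z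
    using G_homeo[of n] that unfolding lip_homeo_def by auto
  have G_base: "G n (x, t) = (x, t + f n x)" if "x \<in> B" "t \<le> - f n x" for n x t
    using that(2)
  proof (induction n arbitrary: t)
    case 0
    then show ?case by (simp add: G_simps f0)
  next
    case (Suc n)
    let ?d = "f (Suc n) x - f n x"
    have "t \<le> - ?d" using Suc.prems f_nonneg[of n x] by simp
    then have "G (Suc n) (x, t) = G n (x, t + ?d)" using base that(1) by (simp add: G_simps)
    also have "\<dots> = (x, t + ?d + f n x)" using Suc.prems by (intro Suc.IH) simp
    finally show ?case by simp
  qed
  have G_stable: "G n w = G m w" if "\<forall>k\<ge>m. \<Phi> k w = w" "n \<ge> m" for n m w
    using that(2)
  proof (induction rule: dec_induct)
    case (step k)
    then show ?case using that(1) by (simp add: G_simps)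
  qed simp
  define F where "F z = G (SOME m. \<forall>k\<ge>m. \<Phi> k z = z) z" for z
  have F_eq: "F w = G n w" if w: "\<forall>k\<ge>m. \<Phi> k w = w" and n: "n \<ge> m" for n m w
  proof -
    define m0 where "m0 = (SOME m. \<forall>k\<ge>m. \<Phi> k w = w)"
    have m0: "\<forall>k\<ge>m0. \<Phi> k w = w" unfolding m0_def by (rule someI[of _ m]) (rule w)
    have "F w = G m0 w" by (simp add: F_def m0_def)
    also have "\<dots> = G (max m0 m) w" using G_stable[OF m0, of "max m0 m"] by simp
    also have "\<dots> = G m w" using G_stable[OF w, of "max m0 m"] by simp
    also have "\<dots> = G n w" using G_stable[OF w n] by simp
    finally show ?thesis .
  qed
  have F_ex: "\<exists>m. \<forall>n\<ge>m. F z = G n z" if z: "z \<in> ?Z" for z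
  proof -
    obtain e m where e: "e > 0" "\<forall>n\<ge>m. \<forall>w\<in>?Z \<inter> ball z e. \<Phi> n w = w" using fin[OF z] by blast
    then have "\<forall>k\<ge>m. \<Phi> k z = z" using z by simp
    then show ?thesis using F_eq by blast
  qed
  have F_local: "\<exists>e>0. \<exists>m. \<forall>w\<in>?Z \<inter> ball z e. F w = G m w" if z: "z \<in> ?Z" for z
  proof -
    obtain e m where e: "e > 0" "\<forall>n\<ge>m. \<forall>w\<in>?Z \<inter> ball z e. \<Phi> n w = w" using fin[OF z] by blast
    have "F w = G m w" if "w \<in> ?Z \<inter> ball z e" for w
    proof (rule F_eq[of m])
      show "\<forall>k\<ge>m. \<Phi> k w = w" using e(2) that by blast
    qed simp
    then show ?thesis using e(1) by blast
  qed
  have F_Z: "F z \<in> ?Z" if z: "z \<in> ?Z" for z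
  proof -
    obtain m where "F z = G m z" using F_ex[OF z] by blast
    then show ?thesis using G_Z(1)[OF z] by simp
  qed
  have F_inj: "z = w" if zw: "z \<in> ?Z" "w \<in> ?Z" "F z = F w" for z w
  proof -
    obtain m m' where m: "\<forall>n\<ge>m. F z = G n z" "\<forall>n\<ge>m'. F w = G n w"
      using F_ex zw by meson
    have "F z = G (max m m') z" "F w = G (max m m') w"
      using m(1)[rule_format, of "max m m'"] m(2)[rule_format, of "max m m'"] by simp_all
    then have "G (max m m') z = G (max m m') w" using zw(3) by metis
    then show ?thesis using G_Z(3)[OF zw(1)] G_Z(3)[OF zw(2)] by metis
  qed
  have F_lip: "locally_lip ?Z F"
  proof (rule locally_lip_cong_nhd)
    fix z assume "z \<in> ?Z"
    then obtain e m where "e > 0" "\<forall>w\<in>?Z \<inter> ball z e. F w = G m w" using F_local by blast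
    then show "\<exists>e>0. \<exists>g. locally_lip ?Z g \<and> (\<forall>y\<in>?Z \<inter> ball z e. F y = g y)"
      using G_homeo[of m] unfolding lip_homeo_def by blast
  qed
  have F_open: "\<exists>d>0. \<exists>L g. L-lipschitz_on (?Z \<inter> ball (F z) d) g \<and>
      (\<forall>w\<in>?Z \<inter> ball (F z) d. g w \<in> ?Z \<inter> ball z \<eta> \<and> F (g w) = w)"
    if z: "z \<in> ?Z" and \<eta>: "\<eta> > 0" for z \<eta>
  proof -
    obtain e m where e: "e > 0" "\<forall>w\<in>?Z \<inter> ball z e. F w = G m w" using F_local[OF z] by blast
    have lip: "locally_lip ?Z (G' m)" using G_homeo[of m] by (simp add: lip_homeo_def)
    have Fz: "F z = G m z" using e z by simp
    then have GFz: "G' m (F z) = z" using G_Z[OF z] by simp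
    obtain d1 L where d1: "d1 > 0" "L-lipschitz_on (?Z \<inter> ball (F z) d1) (G' m)"
      using lip F_Z[OF z] unfolding locally_lip_def by blast
    have "min e \<eta> > 0" using e \<eta> by simp
    then obtain d2 where d2: "d2 > 0"
      "\<And>w. w \<in> ?Z \<Longrightarrow> dist w (F z) < d2 \<Longrightarrow> dist (G' m w) (G' m (F z)) < min e \<eta>"
      using locally_lip_continuous_on[OF lip] F_Z[OF z] unfolding continuous_on_iff by meson
    let ?d = "min d1 d2"
    have "L-lipschitz_on (?Z \<inter> ball (F z) ?d) (G' m)"
      by (rule lipschitz_on_subset[OF d1(2)]) auto
    moreover have "G' m w \<in> ?Z \<inter> ball z \<eta> \<and> F (G' m w) = w" if w: "w \<in> ?Z \<inter> ball (F z) ?d" for w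
    proof -
      have wZ: "w \<in> ?Z" using w by simp
      have "dist (G' m w) z < min e \<eta>" using d2(2)[OF wZ] w by (simp add: GFz dist_commute)
      then have "G' m w \<in> ?Z \<inter> ball z e" "G' m w \<in> ?Z \<inter> ball z \<eta>"
        using G_Z(2)[OF wZ] by (auto simp: dist_commute)
      then show ?thesis using e(2) G_Z(4)[OF wZ] by simp
    qed
    moreover have "?d > 0" using d1 d2 by simp
    ultimately show ?thesis by blast
  qed
  have F_base: "F (x, t) = (x, t + 1)" if x: "x \<in> B" and t: "t \<le> -1" for x t
  proof -
    have "(x, t) \<in> ?Z" using x t by (simp add: outer_collar_def)
    then obtain m where m: "\<forall>n\<ge>m. F (x, t) = G n (x, t)" using F_ex by blast
    obtain m' where m': "\<forall>n\<ge>m'. f n x = 1" using f1[OF x] by blast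
    let ?n = "max m m'"
    have "F (x, t) = G ?n (x, t)" "f ?n x = 1" using m m' by auto
    then show ?thesis using G_base[OF x, of t ?n] t by simp
  qed
  define S where "S = B \<times> {0..1::real}"
  define j where "j p = (fst p, snd p - 1)" for p :: "'a \<times> real"
  define c where "c p = fst (F (j p))" for p
  have j_Z: "j p \<in> ?Z" if "p \<in> S" for p using that by (auto simp: j_def S_def outer_collar_def)
  have j_inj: "j p = j q \<longleftrightarrow> p = q" for p q by (auto simp: j_def prod_eq_iff)
  \<comment> \<open>The points of \<open>B \<times> (-\<infinity>, 0)\<close> are already the images of \<open>B \<times> (-\<infinity>, -1)\<close>, so nothing else is
    mapped below level \<open>0\<close>. The same argument with \<open>B \<times> {0}\<close> yields \<open>c_B\<close>.\<close>
  have level: "F (j p) = (c p, 0)" if p: "p \<in> S" for p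
  proof -
    have "\<not> snd (F (j p)) < 0"
    proof
      assume neg: "snd (F (j p)) < 0"
      define b s where "b = fst (F (j p))" "s = snd (F (j p))"
      have b: "b \<in> B" "s < 0" "F (j p) = (b, s)"
        using F_Z[OF j_Z[OF p]] neg by (auto simp: b_s_def outer_collar_def)
      then have "F (b, s - 1) = F (j p)" using F_base[of b "s - 1"] by simp
      moreover have "(b, s - 1) \<in> ?Z" using b by (simp add: outer_collar_def)
      ultimately have "(b, s - 1) = j p" using F_inj j_Z[OF p] by blast
      then show False using p b by (auto simp: j_def S_def)
    qed
    then show ?thesis using F_Z[OF j_Z[OF p]] by (auto simp: c_def prod_eq_iff outer_collar_def)
  qed
  have c_inj: "inj_on c S"
  proof (rule inj_onI)
    fix p q assume pq: "p \<in> S" "q \<in> S" "c p = c q"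
    then have "F (j p) = F (j q)" using level by simp
    then show "p = q" using F_inj[OF j_Z[OF pq(1)] j_Z[OF pq(2)]] j_inj by blast
  qed
  have c_base: "c (x, 0) = x" if "x \<in> B" for x
    using F_base[OF that, of "-1"] by (simp add: c_def j_def)
  have j_lip: "1-lipschitz_on S j" for S
    by (rule lipschitz_onI) (auto simp: j_def dist_prod_def dist_real_def)
  have c_lip: "locally_lip S c"
  proof -
    have "locally_lip S j" unfolding locally_lip_def using j_lip zero_less_one by blast
    then have Fj: "locally_lip S (\<lambda>p. F (j p))"
      using F_lip j_Z by (rule locally_lip_compose)
    have "1-lipschitz_on A fst" for A :: "('a \<times> real) set"
      by (rule lipschitz_onI) (auto simp: dist_fst_le)
    then have "locally_lip UNIV (fst :: 'a \<times> real \<Rightarrow> 'a)"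
      unfolding locally_lip_def using zero_less_one by blast
    from locally_lip_compose[OF Fj this] show ?thesis unfolding c_def by simp
  qed
  define i where "i = inv_into S c"
  have i_c: "i (c p) = p" if "p \<in> S" for p using that c_inj by (simp add: i_def)
  have i_lip: "locally_lip (c ` S) i"
    unfolding locally_lip_def
  proof
    fix y assume "y \<in> c ` S"
    then obtain p where p: "p \<in> S" "y = c p" by blast
    obtain d L g where d: "d > 0" "L-lipschitz_on (?Z \<inter> ball (F (j p)) d) g"
      "\<forall>w\<in>?Z \<inter> ball (F (j p)) d. g w \<in> ?Z \<inter> ball (j p) 1 \<and> F (g w) = w"
      using F_open[OF j_Z[OF p(1)] zero_less_one] by blast
    have g: "(v, 0) \<in> ?Z \<inter> ball (F (j p)) d \<and> g (v, 0) = j (i v)" if v: "v \<in> c ` S \<inter> ball y d" for v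
    proof -
      obtain q where q: "q \<in> S" "v = c q" using v by blast
      have "dist (F (j p)) (v, 0) = dist y v"
        using level[OF p(1)] p(2) by (simp add: dist_prod_def)
      then have w: "(v, 0) \<in> ?Z \<inter> ball (F (j p)) d"
        using v by (auto simp: outer_collar_def)
      then have "g (v, 0) \<in> ?Z" "F (g (v, 0)) = F (j q)" using d(3) level[OF q(1)] q(2) by auto
      then have "g (v, 0) = j q" using F_inj j_Z[OF q(1)] by blast
      then show ?thesis using w i_c[OF q(1)] q(2) by simp
    qed
    have "L-lipschitz_on (c ` S \<inter> ball y d) i"
    proof (rule lipschitz_onI)
      show "0 \<le> L" using d(2) by (rule lipschitz_on_nonneg)
      fix v w assume vw: "v \<in> c ` S \<inter> ball y d" "w \<in> c ` S \<inter> ball y d"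
      have "dist (i v) (i w) = dist (j (i v)) (j (i w))"
        by (simp add: j_def dist_prod_def dist_real_def)
      also have "\<dots> = dist (g (v, 0)) (g (w, 0))" using g[OF vw(1)] g[OF vw(2)] by simp
      also have "\<dots> \<le> L * dist (v, 0::real) (w, 0)"
        using g[OF vw(1)] g[OF vw(2)] by (intro lipschitz_onD[OF d(2)]) auto
      finally show "dist (i v) (i w) \<le> L * dist v w" by (simp add: dist_prod_def)
    qed
    then show "\<exists>e>0. \<exists>L. L-lipschitz_on (c ` S \<inter> ball y e) i" using d(1) by blast
  qed
  have emb: "embedding_on S c"
  proof -
    have "i ` c ` S = S" using i_c by (simp add: image_image)
    then have "homeomorphism S (c ` S) c i"
      unfolding homeomorphism_def
      using locally_lip_continuous_on[OF c_lip] locally_lip_continuous_on[OF i_lip] i_c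
      by simp
    then show ?thesis unfolding embedding_on_def by blast
  qed
  have LIP: "LIP_embedding_on dist_sum dist S c"
    unfolding LIP_embedding_on_def
  proof (intro conjI emb)
    show "locally_lipschitz_on dist_sum dist S c"
      by (rule locally_lip_imp_locally_lipschitz_on[OF c_lip]) (auto simp: dist_le_dist_sum)
    show "locally_lipschitz_on dist dist_sum (c ` S) (inv_into S c)"
      using i_lip unfolding i_def
      by (rule locally_lip_imp_locally_lipschitz_on) (auto simp: dist_sum_le_dist)
  qed
  have c_B: "snd p = 0" if p: "p \<in> S" "c p \<in> B" for p
  proof -
    have "F (c p, -1) = F (j p)" using F_base[OF p(2), of "-1"] level[OF p(1)] by simp
    moreover have "(c p, -1) \<in> ?Z" using p by (simp add: outer_collar_def)
    ultimately have "(c p, -1) = j p" using F_inj j_Z[OF p(1)] by blast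
    then show ?thesis by (simp add: j_def prod_eq_iff)
  qed
  \<comment> \<open>By \<open>F_open\<close> with \<open>\<eta> = 1 - t\<close>, points near \<open>c (x, t)\<close> have preimages below level \<open>0\<close>, that is,
    over \<open>B\<close>, and these are not below level \<open>-1\<close> because their images have level \<open>0\<close>.\<close>
  have c_open: "open (c ` (B \<times> {0..<1}))"
    unfolding open_contains_ball
  proof
    fix y assume "y \<in> c ` (B \<times> {0..<1})"
    then obtain x t where x: "x \<in> B" "0 \<le> t" "t < 1" "y = c (x, t)" by auto
    then have p: "(x, t) \<in> S" by (simp add: S_def)
    obtain d L g where d: "d > 0"
      "\<forall>w\<in>?Z \<inter> ball (F (j (x, t))) d. g w \<in> ?Z \<inter> ball (j (x, t)) (1 - t) \<and> F (g w) = w"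
      using F_open[OF j_Z[OF p], of "1 - t"] x by auto
    have "v \<in> c ` (B \<times> {0..<1})" if v: "v \<in> ball y d" for v
    proof -
      have "dist (F (j (x, t))) (v, 0) = dist y v"
        using level[OF p] x(4) by (simp add: dist_prod_def)
      then have "(v, 0) \<in> ?Z \<inter> ball (F (j (x, t))) d"
        using v by (auto simp: outer_collar_def)
      then have "g (v, 0) \<in> ?Z \<inter> ball (j (x, t)) (1 - t)" "F (g (v, 0)) = (v, 0)" using d(2) by auto
      then obtain b s where b: "(b, s) \<in> ?Z" "dist (j (x, t)) (b, s) < 1 - t" "F (b, s) = (v, 0)"
        by (cases "g (v, 0)") auto
      have "\<bar>(t - 1) - s\<bar> < 1 - t"
        using b(2) dist_snd_le[of "j (x, t)" "(b, s)"] by (simp add: j_def dist_real_def)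
      then have s: "s < 0" by linarith
      then have bB: "b \<in> B" using b(1) by (simp add: outer_collar_def)
      have "-1 \<le> s" using F_base[OF bB, of s] b(3) by (cases "s \<le> -1") auto
      then have "(b, s + 1) \<in> B \<times> {0..<1}" "c (b, s + 1) = v"
        using s bB b(3) by (auto simp: c_def j_def)
      then show ?thesis by (metis imageI)
    qed
    then show "\<exists>e>0. ball y e \<subseteq> c ` (B \<times> {0..<1})" using d(1) by blast
  qed
  have "{p \<in> S. c p \<in> B} = B \<times> {0}"
    using c_B c_base by (fastforce simp: S_def)
  then have "LIP_collar B c"
    using emb c_base c_open LIP \<open>closed B\<close>
    unfolding LIP_collar_def collar_def local_collar_def S_def by simp
  then show ?thesis unfolding LIP_collared_def by blast
qed


section \<open>Lipschitz functions telescoping to one\<close>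

text \<open>Let \<open>h n\<close> be a bump that is \<open>1\<close> within \<open>1 / 2\<^sup>n\<close> of \<open>A n\<close> and \<open>0\<close> beyond \<open>2 / 2\<^sup>n\<close>, and let \<open>f n\<close>
  be the maximum of the first \<open>n\<close> bumps. The increments of \<open>f\<close> then behave like a partition of
  unity: they add up to \<open>1\<close> on \<open>B\<close>, each is supported where its bump is, and all increments after
  the \<open>m\<close>-th vanish where \<open>h m\<close> is \<open>1\<close>. So they are locally finite even though the bumps
  themselves may not be.\<close>

lemma telescoping_bumps:
  fixes A :: "nat \<Rightarrow> 'a::metric_space set"
  assumes cover: "\<And>x. x \<in> B \<Longrightarrow> \<exists>n. x \<in> A n"
  obtains f :: "nat \<Rightarrow> 'a \<Rightarrow> real" where
    "\<And>x. f 0 x = 0" "\<And>n x. 0 \<le> f n x" "\<And>n x. f n x \<le> f (Suc n) x" "\<And>n x. f n x \<le> 1"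
    "\<And>n. \<exists>K. K-lipschitz_on UNIV (\<lambda>x. f (Suc n) x - f n x)"
    "\<And>n x. f (Suc n) x \<noteq> f n x \<Longrightarrow> \<exists>y\<in>A n. dist x y < 2 / 2 ^ n"
    "\<And>x. x \<in> B \<Longrightarrow> \<exists>m. \<forall>y. dist y x < 1 / 2 ^ m \<longrightarrow> (\<forall>n>m. f n y = 1)"
proof -
  define \<delta> :: "nat \<Rightarrow> real" where "\<delta> n = 1 / 2 ^ n" for n
  \<comment> \<open>The case distinction is for the convention that the distance from the empty set is \<open>0\<close>.\<close>
  define h where "h n x = (if A n = {} then 0 else max 0 (min 1 (2 - 2 ^ n * infdist x (A n))))" for n x
  define f where "f = rec_nat (\<lambda>x. 0) (\<lambda>n g x. max (g x) (h n x))"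
  have f_simps: "f 0 x = 0" "f (Suc n) x = max (f n x) (h n x)" for n x
    by (simp_all add: f_def)
  have h_range: "0 \<le> h n x" "h n x \<le> 1" for n x by (auto simp: h_def)
  have h_supp: "\<exists>y\<in>A n. dist x y < 2 * \<delta> n" if h: "h n x \<noteq> 0" for n x
  proof -
    have ne: "A n \<noteq> {}" using h by (auto simp: h_def)
    have "2 ^ n * infdist x (A n) < 2" using h ne by (auto simp: h_def max_def min_def split: if_splits)
    then have "infdist x (A n) < 2 * \<delta> n" by (simp add: \<delta>_def field_simps)
    then obtain y where "y \<in> A n" "dist x y < 2 * \<delta> n" using infdist_less_imp_dist ne by blast
    then show ?thesis by blast
  qed
  have h_one: "h n x = 1" if y: "y \<in> A n" "dist x y < \<delta> n" for n x y
  proof -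
    have "infdist x (A n) \<le> \<delta> n" using infdist_le2[OF y(1)] y(2) by simp
    then have "2 ^ n * infdist x (A n) \<le> 1" by (simp add: \<delta>_def field_simps)
    then show ?thesis using y by (auto simp: h_def)
  qed
  have h_lip: "(2 ^ n)-lipschitz_on UNIV (h n)" for n
  proof (rule lipschitz_onI)
    fix x y
    have clamp: "\<bar>max 0 (min 1 (2 - u)) - max 0 (min 1 (2 - v))\<bar> \<le> \<bar>u - v\<bar>" for u v :: real
      by (auto simp: max_def min_def)
    have "dist (h n x) (h n y) \<le> \<bar>2 ^ n * infdist x (A n) - 2 ^ n * infdist y (A n)\<bar>"
      using clamp by (simp add: h_def dist_real_def)
    also have "\<dots> = 2 ^ n * \<bar>infdist x (A n) - infdist y (A n)\<bar>"
      by (simp add: abs_mult flip: right_diff_distrib)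
    also have "\<dots> \<le> 2 ^ n * dist x y"
      by (intro mult_left_mono infdist_triangle_abs) simp
    finally show "dist (h n x) (h n y) \<le> 2 ^ n * dist x y" .
  qed simp
  have f_range: "0 \<le> f n x \<and> f n x \<le> 1" for n x
    using h_range by (induction n) (auto simp: f_simps)
  have f_lip: "\<exists>K. K-lipschitz_on UNIV (f n)" for n
  proof (induction n)
    case 0
    have "0-lipschitz_on UNIV (f 0)" by (rule lipschitz_onI) (auto simp: f_simps)
    then show ?case by blast
  next
    case (Suc n)
    then obtain K where K: "K-lipschitz_on UNIV (f n)" by blast
    have "(K + 2 ^ n)-lipschitz_on UNIV (f (Suc n))"
    proof (rule lipschitz_onI)
      show "0 \<le> K + 2 ^ n" using lipschitz_on_nonneg[OF K] by simp
      fix x y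
      have m: "\<bar>max a b - max c d\<bar> \<le> \<bar>a - c\<bar> + \<bar>b - d\<bar>" for a b c d :: real
        by (auto simp: max_def)
      have "dist (f (Suc n) x) (f (Suc n) y) \<le> dist (f n x) (f n y) + dist (h n x) (h n y)"
        using m by (simp add: f_simps dist_real_def)
      also have "\<dots> \<le> K * dist x y + 2 ^ n * dist x y"
        by (intro add_mono lipschitz_onD[OF K] lipschitz_onD[OF h_lip]) auto
      finally show "dist (f (Suc n) x) (f (Suc n) y) \<le> (K + 2 ^ n) * dist x y"
        by (simp add: distrib_right)
    qed
    then show ?case by blast
  qed
  define \<phi> where "\<phi> n x = f (Suc n) x - f n x" for n x
  have \<phi>_supp: "h n x \<noteq> 0" if "\<phi> n x \<noteq> 0" for n x
    using that f_range[of n x] h_range[of n x] by (auto simp: \<phi>_def f_simps max_def split: if_splits)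
  have \<phi>_lip: "\<exists>K. K-lipschitz_on UNIV (\<phi> n)" for n
  proof -
    obtain K K' where K: "K-lipschitz_on UNIV (f (Suc n))" "K'-lipschitz_on UNIV (f n)"
      using f_lip by meson
    have "(K + K')-lipschitz_on UNIV (\<phi> n)"
    proof (rule lipschitz_onI)
      show "0 \<le> K + K'" using lipschitz_on_nonneg[OF K(1)] lipschitz_on_nonneg[OF K(2)] by simp
      fix x y
      have "dist (\<phi> n x) (\<phi> n y) \<le> dist (f (Suc n) x) (f (Suc n) y) + dist (f n x) (f n y)"
        unfolding \<phi>_def dist_real_def by linarith
      also have "\<dots> \<le> K * dist x y + K' * dist x y"
        by (intro add_mono lipschitz_onD[OF K(1)] lipschitz_onD[OF K(2)]) auto
      finally show "dist (\<phi> n x) (\<phi> n y) \<le> (K + K') * dist x y" by (simp add: distrib_right)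
    qed
    then show ?thesis by blast
  qed
  have f_one: "f n x = 1" if "h m x = 1" "n > m" for n m x
  proof -
    have "1 \<le> f n x"
      using that(2)
    proof (induction n)
      case (Suc n)
      then show ?case using that(1) by (cases "n = m") (auto simp: f_simps)
    qed simp
    then show ?thesis using f_range[of n x] by simp
  qed
  show thesis
  proof (rule that[of f])
    show "f 0 x = 0" "0 \<le> f n x" "f n x \<le> f (Suc n) x" "f n x \<le> 1" for n x
      using f_range[of n x] by (auto simp: f_simps)
    show "\<exists>K. K-lipschitz_on UNIV (\<lambda>x. f (Suc n) x - f n x)" for n
      using \<phi>_lip[of n] unfolding \<phi>_def .
    show "\<exists>y\<in>A n. dist x y < 2 / 2 ^ n" if "f (Suc n) x \<noteq> f n x" for n x
      using h_supp[of n x] \<phi>_supp[of n x] that by (simp add: \<delta>_def \<phi>_def)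
    show "\<exists>m. \<forall>y. dist y x < 1 / 2 ^ m \<longrightarrow> (\<forall>n>m. f n y = 1)" if "x \<in> B" for x
    proof -
      obtain m where "x \<in> A m" using cover[OF \<open>x \<in> B\<close>] by blast
      then show ?thesis using h_one f_one unfolding \<delta>_def by blast
    qed
  qed
qed

section \<open>From local collars to a collar\<close>

theorem theorem7p8:
  fixes B :: "'a::metric_space set"
  assumes "closed B"
    and "locally_LIP_collared B"
  shows "LIP_collared B"
proof -
  have "\<forall>a\<in>B. \<exists>r>0. \<forall>\<delta>>0. collar_patches B (ball a r) \<delta>"
    using local_collar_patches[OF assms(2)] by metis
  then obtain r where r: "\<And>a. a \<in> B \<Longrightarrow> r a > 0"
    and patches: "\<And>a \<delta>. a \<in> B \<Longrightarrow> \<delta> > 0 \<Longrightarrow> collar_patches B (ball a (r a)) \<delta>"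
    by metis
  define W where "W a = ball a (r a)" for a
  have W: "open (W a) \<and> a \<in> W a" if "a \<in> B" for a using r[OF that] by (simp add: W_def)
  obtain E where E_cover: "\<And>x. x \<in> B \<Longrightarrow> \<exists>n. \<exists>a\<in>B. x \<in> E n a"
    and E_W: "\<And>n a y. y \<in> E n a \<Longrightarrow> ball y (8 / 2 ^ n) \<subseteq> W a"
    and E_sep: "\<And>n a b y z. a \<in> B \<Longrightarrow> b \<in> B \<Longrightarrow> a \<noteq> b \<Longrightarrow> y \<in> E n a \<Longrightarrow> z \<in> E n b \<Longrightarrow>
      8 / 2 ^ n \<le> dist y z"
  proof (rule separated_refinement[OF W])
    fix E :: "nat \<Rightarrow> 'a \<Rightarrow> 'a set"
    assume "\<And>x. x \<in> B \<Longrightarrow> \<exists>n. \<exists>a\<in>B. x \<in> E n a"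
      and "\<And>n a y. y \<in> E n a \<Longrightarrow> ball y (8 / 2 ^ n) \<subseteq> W a"
      and "\<And>n a b y z. a \<in> B \<Longrightarrow> b \<in> B \<Longrightarrow> a \<noteq> b \<Longrightarrow> y \<in> E n a \<Longrightarrow> z \<in> E n b \<Longrightarrow>
        8 / 2 ^ n \<le> dist y z"
    then show thesis by (rule that)
  qed
  define A where "A n = (\<Union>a\<in>B. E n a)" for n
  define \<delta> :: "nat \<Rightarrow> real" where "\<delta> n = 1 / 2 ^ n" for n
  have \<delta>: "\<delta> n > 0" for n by (simp add: \<delta>_def)
  have A_cover: "\<exists>n. x \<in> A n" if "x \<in> B" for x using E_cover[OF that] by (auto simp: A_def)
  obtain f :: "nat \<Rightarrow> 'a \<Rightarrow> real" where f0: "\<And>x. f 0 x = 0"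
    and f_range: "\<And>n x. 0 \<le> f n x" "\<And>n x. f n x \<le> f (Suc n) x" "\<And>n x. f n x \<le> 1"
    and f_lip: "\<And>n. \<exists>K. K-lipschitz_on UNIV (\<lambda>x. f (Suc n) x - f n x)"
    and f_supp: "\<And>n x. f (Suc n) x \<noteq> f n x \<Longrightarrow> \<exists>y\<in>A n. dist x y < 2 / 2 ^ n"
    and f_core: "\<And>x. x \<in> B \<Longrightarrow> \<exists>m. \<forall>y. dist y x < 1 / 2 ^ m \<longrightarrow> (\<forall>n>m. f n y = 1)"
  proof (rule telescoping_bumps[OF A_cover])
    fix f :: "nat \<Rightarrow> 'a \<Rightarrow> real"
    assume "\<And>x. f 0 x = 0"
      and "\<And>n x. 0 \<le> f n x" "\<And>n x. f n x \<le> f (Suc n) x" "\<And>n x. f n x \<le> 1"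
      and "\<And>n. \<exists>K. K-lipschitz_on UNIV (\<lambda>x. f (Suc n) x - f n x)"
      and "\<And>n x. f (Suc n) x \<noteq> f n x \<Longrightarrow> \<exists>y\<in>A n. dist x y < 2 / 2 ^ n"
      and "\<And>x. x \<in> B \<Longrightarrow> \<exists>m. \<forall>y. dist y x < 1 / 2 ^ m \<longrightarrow> (\<forall>n>m. f n y = 1)"
    then show thesis by (rule that)
  qed
  define \<phi> where "\<phi> n x = f (Suc n) x - f n x" for n x
  have \<phi>_range: "0 \<le> \<phi> n x \<and> \<phi> n x \<le> 1" for n x
    using f_range(1)[of n x] f_range(2)[of n x] f_range(3)[of "Suc n" x] by (simp add: \<phi>_def)
  have \<phi>_supp: "\<exists>a\<in>B. \<exists>y\<in>E n a. dist x y < 2 * \<delta> n" if "\<phi> n x \<noteq> 0" for n x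
    using f_supp[of n x] that by (auto simp: \<phi>_def \<delta>_def A_def)
  have core: "\<exists>m. \<forall>y. dist y x < \<delta> m \<longrightarrow> (\<forall>n>m. f n y = 1)" if "x \<in> B" for x
    using f_core[OF that] by (simp add: \<delta>_def)
  let ?Z = "outer_collar B"
  have "\<exists>\<Phi> \<Phi>'. lip_homeo ?Z \<Phi> \<Phi>' \<and>
      (\<forall>x\<in>B. \<forall>t. t \<le> - \<phi> n x \<longrightarrow> \<Phi> (x, t) = (x, t + \<phi> n x)) \<and>
      (\<forall>z\<in>?Z. \<Phi> z \<noteq> z \<longrightarrow> (\<exists>x\<in>B. \<phi> n x \<noteq> 0 \<and> dist (fst z) x \<le> \<delta> n))" for n
  proof -
    obtain K where K: "K-lipschitz_on UNIV (\<phi> n)" using f_lip[of n] unfolding \<phi>_def by blast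
    obtain \<Phi> \<Phi>' where \<Phi>: "lip_homeo ?Z \<Phi> \<Phi>'"
      "\<And>x t. x \<in> B \<Longrightarrow> t \<le> - \<phi> n x \<Longrightarrow> \<Phi> (x, t) = (x, t + \<phi> n x)"
      "\<And>z. z \<in> ?Z \<Longrightarrow> \<Phi> z \<noteq> z \<Longrightarrow> \<exists>x\<in>B. \<phi> n x \<noteq> 0 \<and> dist (fst z) x \<le> \<delta> n"
    proof (rule push_separated_family[of B "\<delta> n" W "E n" K "\<phi> n"])
      fix \<Phi> \<Phi>'
      assume "lip_homeo ?Z \<Phi> \<Phi>'" and "\<And>x t. x \<in> B \<Longrightarrow> t \<le> - \<phi> n x \<Longrightarrow> \<Phi> (x, t) = (x, t + \<phi> n x)"
        and "\<And>z. z \<in> ?Z \<Longrightarrow> \<Phi> z \<noteq> z \<Longrightarrow> \<exists>x\<in>B. \<phi> n x \<noteq> 0 \<and> dist (fst z) x \<le> \<delta> n"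
      then show thesis by (rule that)
    next
      show "collar_patches B (W a) (\<delta> n)" if "a \<in> B" for a
        unfolding W_def using patches[OF that \<delta>] .
      show "ball y (8 * \<delta> n) \<subseteq> W a" if "y \<in> E n a" for a y
        using E_W[OF that] by (simp add: \<delta>_def)
      show "8 * \<delta> n \<le> dist y z" if "a \<in> B" "b \<in> B" "a \<noteq> b" "y \<in> E n a" "z \<in> E n b" for a b y z
        using E_sep[OF that] by (simp add: \<delta>_def)
      show "\<exists>a\<in>B. \<exists>y\<in>E n a. dist x y < 2 * \<delta> n" if "\<phi> n x \<noteq> 0" for x
        by (rule \<phi>_supp[OF that])
    qed (use \<open>closed B\<close> \<delta> K \<phi>_range in auto)
    then show ?thesis by blast
  qed
  then obtain \<Phi> \<Phi>' where \<Phi>: "\<And>n. lip_homeo ?Z (\<Phi> n) (\<Phi>' n) \<and>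
      (\<forall>x\<in>B. \<forall>t. t \<le> - \<phi> n x \<longrightarrow> \<Phi> n (x, t) = (x, t + \<phi> n x)) \<and>
      (\<forall>z\<in>?Z. \<Phi> n z \<noteq> z \<longrightarrow> (\<exists>x\<in>B. \<phi> n x \<noteq> 0 \<and> dist (fst z) x \<le> \<delta> n))"
    by metis
  have \<delta>_small: "\<exists>m. \<forall>n\<ge>m. \<delta> n < e" if e: "e > 0" for e
  proof -
    obtain m where m: "(1 / 2) ^ m < e" using real_arch_pow_inv[of e "1 / 2"] e by auto
    have "\<delta> n < e" if "n \<ge> m" for n
    proof -
      have "\<delta> n \<le> \<delta> m" using that by (simp add: \<delta>_def field_simps)
      then show ?thesis using m by (simp add: \<delta>_def power_one_over)
    qed
    then show ?thesis by blast
  qed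
  show ?thesis
  proof (rule collar_from_pushes[of B \<Phi> \<Phi>' f])
    show "closed B" by fact
    show "lip_homeo ?Z (\<Phi> n) (\<Phi>' n)" for n using \<Phi>[of n] by blast
    show "\<Phi> n (x, t) = (x, t + (f (Suc n) x - f n x))"
      if "x \<in> B" "t \<le> - (f (Suc n) x - f n x)" for n x t
      using \<Phi>[of n] that unfolding \<phi>_def by blast
    show "f 0 x = 0" "0 \<le> f n x" for n x using f0 f_range(1) by auto
    show "\<exists>m. \<forall>n\<ge>m. f n x = 1" if x: "x \<in> B" for x
    proof -
      obtain m where m: "\<forall>y. dist y x < \<delta> m \<longrightarrow> (\<forall>n>m. f n y = 1)" using core[OF x] by blast
      then have "\<forall>n\<ge>Suc m. f n x = 1" using \<delta>[of m] by simp
      then show ?thesis by blast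
    qed
    fix z assume z: "z \<in> ?Z"
    \<comment> \<open>On \<open>B\<close> the increments are locally finite; a point off \<open>B\<close> has a positive distance from the
      closed set \<open>B\<close>. Since the \<open>n\<close>-th push stays within \<open>\<delta> n\<close> of the support of \<open>\<phi> n\<close>, this
      makes the pushes locally finite on the outer collar.\<close>
    have "\<exists>e>0. \<exists>m. \<forall>n\<ge>m. \<forall>x\<in>B. dist (fst z) x < e \<longrightarrow> \<phi> n x = 0"
    proof (cases "fst z \<in> B")
      case True
      then obtain m where m: "\<forall>y. dist y (fst z) < \<delta> m \<longrightarrow> (\<forall>n>m. f n y = 1)" using core by blast
      have "\<phi> n x = 0" if "n \<ge> Suc m" "dist (fst z) x < \<delta> m" for n x
        using m that by (simp add: \<phi>_def dist_commute)
      then show ?thesis using \<delta>[of m] by blast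
    next
      case False
      then obtain e where "e > 0" "ball (fst z) e \<subseteq> - B"
        using \<open>closed B\<close> open_contains_ball by (metis ComplI open_Compl)
      then have "\<not> dist (fst z) x < e" if "x \<in> B" for x using that by auto
      then show ?thesis using \<open>e > 0\<close> by blast
    qed
    then obtain e m where e: "e > 0" "\<And>n x. n \<ge> m \<Longrightarrow> x \<in> B \<Longrightarrow> dist (fst z) x < e \<Longrightarrow> \<phi> n x = 0"
      by blast
    obtain m' where m': "\<forall>n\<ge>m'. \<delta> n < e / 2" using \<delta>_small[of "e / 2"] e(1) by auto
    have "\<Phi> n w = w" if n: "n \<ge> max m m'" and w: "w \<in> ?Z \<inter> ball z (e / 2)" for n w
    proof (rule ccontr)
      assume "\<Phi> n w \<noteq> w"
      then obtain x where x: "x \<in> B" "\<phi> n x \<noteq> 0" "dist (fst w) x \<le> \<delta> n" using \<Phi>[of n] w by blast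
      have "dist (fst z) x \<le> dist (fst z) (fst w) + dist (fst w) x" by (rule dist_triangle)
      also have "\<dots> < e / 2 + e / 2"
      proof (rule add_strict_mono)
        show "dist (fst z) (fst w) < e / 2" using w dist_fst_le[of z w] by simp
        have "\<delta> n < e / 2" using m' n by simp
        then show "dist (fst w) x < e / 2" using x(3) by simp
      qed
      finally show False using e(2)[of n x] n x by simp
    qed
    moreover have "e / 2 > 0" using e(1) by simp
    ultimately show "\<exists>e>0. \<exists>m. \<forall>n\<ge>m. \<forall>w\<in>?Z \<inter> ball z e. \<Phi> n w = w"
      by blast
  qed
qed

end
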